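(* Let $E$ be a holomorphic vector bundle over a domain $D\subset\mathbb{C}^n$, and let $h$ be a singular Finsler metric on $E$ such that $|s|_{h^*}$ is upper semi-continuous for any local holomorphic section $s$ of $E^*$. If $(E,h)$ satisfies the multiple coarse $L^p$-extension condition for some $p>0$, then $(E,h)$ is Griffiths semi-positive.
   Context: A (singular) Finsler metric $h$ on a holomorphic vector bundle $E$ is a function $h:E\to[0,+\infty]$ such that, writing $|v|_h^2:=h(v)$, one has $|cv|^2_h=|c|^2|v|_h^2$ for all $v\in E$, $c\in\mathbb C$. The dual Finsler metric $h^*$ on $E^*$ is defined as follows: for $\xi\in E^*_x$, $|\xi|_{h^*}:=0$ if $|v|_h=+\infty$ for all nonzero $v\in E_x$; otherwise $|\xi|_{h^*}:=\sup\{|\xi(v)|: v\in E_x,\ |v|_h\leq1\}\le+\infty$. $(E,h)$ is Griffiths semi-positive (positively curved in the sense of Griffiths) if for any local holomorphic section $s$ of $E^*$, the function $\log|s|^2_{h^*}$ is plurisubharmonic. Multiple coarse $L^p$-extension condition: there are constants $C_m$ ($m\ge1$), independent of $z$ and satisfying the growth condition $\frac1m\log C_m\to0$ as $m\to\infty$, such that for any $z\in D$, any $a\in E_z$ with $|a|_h=1$, and any $m\geq1$, there is $f_m\in H^0(D,E^{\otimes m})$ such that $f_m(z)=a^{\otimes m}$ and $$\int_D|f_m|^p_{h^{\otimes m}}\leq C_m,$$ the integral being with respect to Lebesgue measure. Here $h^{\otimes m}$ is the Finsler metric on $E^{\otimes m}$ induced by $h$ (the usual tensor power metric when $h$ is Hermitian);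 it satisfies $|\langle u^{\otimes m},\xi\rangle|\le|u|_{h^*}^m\,|\xi|_{h^{\otimes m}}$ for all $u\in E_x^*$, $\xi\in E_x^{\otimes m}$ (with no requirement when the right-hand side is of the form $0\cdot\infty$). The rank of $E$ may be finite or infinite (in the infinite rank case the fibers are modeled on a separable complex Hilbert space).
   Formalization: Upper semi-continuity of |s|_{h*} is taken to include |s|_{h*} < +∞ everywhere; otherwise the claim fails, e.g. for the trivial line bundle on the unit disc with |v|_h=|v| for z≠0 and h=0 at z=0. Plurisubharmonicity of log|s|²_{h*} forces this finiteness anyway. *)

theory Defs
  imports "HOL-Analysis.Analysis"
begin

section \<open>Complex normed spaces and Hilbert spaces\<close>

class complex_normed = real_normed_vector +
  fixes scaleC :: "complex \<Rightarrow> 'a \<Rightarrow> 'a" (infixr "*\<^sub>C" 75)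
  assumes scaleC_add_right: "c *\<^sub>C (x + y) = c *\<^sub>C x + c *\<^sub>C y"
    and scaleC_add_left: "(c + d) *\<^sub>C x = c *\<^sub>C x + d *\<^sub>C x"
    and scaleC_scaleC: "c *\<^sub>C (d *\<^sub>C x) = (c * d) *\<^sub>C x"
    and scaleC_of_real: "complex_of_real r *\<^sub>C x = r *\<^sub>R x"
    and norm_scaleC: "norm (c *\<^sub>C x) = cmod c * norm x"

text \<open>Separable complex Hilbert spaces, of finite or infinite dimension (for a metric space,
  second countability is separability). The inner product is linear in its first argument; its real
  part is the inner product of the class \<^class>\<open>real_inner\<close>, which therefore supplies
  positive definiteness and the norm.\<close>

class complex_hilbert = complex_normed + real_inner + complete_space + second_countable_topology +
  fixes cinner :: "'a \<Rightarrow> 'a \<Rightarrow> complex"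
  assumes cinner_commute: "cinner x y = cnj (cinner y x)"
    and cinner_add_left: "cinner (x + y) z = cinner x z + cinner y z"
    and cinner_scaleC_left: "cinner (c *\<^sub>C x) y = c * cinner x y"
    and Re_cinner: "Re (cinner x y) = inner x y"

instantiation complex :: complex_normed
begin
definition scaleC_complex :: "complex \<Rightarrow> complex \<Rightarrow> complex"
  where "scaleC_complex c x = c * x"
instance
  by standard (auto simp: scaleC_complex_def algebra_simps norm_mult scaleR_conv_of_real)
end

lemma bounded_linear_scaleC: "bounded_linear (\<lambda>x. c *\<^sub>C (x :: 'a :: complex_normed))"
proof
  show "c *\<^sub>C (x + y) = c *\<^sub>C x + c *\<^sub>C y" for x y :: 'a
    by (rule scaleC_add_right)
  show "c *\<^sub>C (r *\<^sub>R x) = r *\<^sub>R (c *\<^sub>C x)" for r and x :: 'a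
    by (simp add: scaleC_of_real[symmetric] scaleC_scaleC mult.commute)
  show "\<exists>K. \<forall>x :: 'a. norm (c *\<^sub>C x) \<le> norm x * K"
    by (rule exI[of _ "cmod c"]) (simp add: norm_scaleC mult.commute)
qed

instantiation blinfun :: (real_normed_vector, complex_normed) complex_normed
begin
definition scaleC_blinfun :: "complex \<Rightarrow> 'a \<Rightarrow>\<^sub>L 'b \<Rightarrow> 'a \<Rightarrow>\<^sub>L 'b"
  where "scaleC_blinfun c f = Blinfun (\<lambda>x. c *\<^sub>C blinfun_apply f x)"

lemma scaleC_blinfun_apply: "blinfun_apply (c *\<^sub>C f) x = c *\<^sub>C blinfun_apply f x"
  unfolding scaleC_blinfun_def
  by (subst bounded_linear_Blinfun_apply)
    (auto intro: bounded_linear_compose[OF bounded_linear_scaleC] blinfun.bounded_linear_right)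

instance
proof
  fix c d :: complex and r :: real and f g :: "'a \<Rightarrow>\<^sub>L 'b"
  show "c *\<^sub>C (f + g) = c *\<^sub>C f + c *\<^sub>C g"
    by (rule blinfun_eqI) (simp add: scaleC_blinfun_apply blinfun.add_left scaleC_add_right)
  show "(c + d) *\<^sub>C f = c *\<^sub>C f + d *\<^sub>C f"
    by (rule blinfun_eqI) (simp add: scaleC_blinfun_apply blinfun.add_left scaleC_add_left)
  show "c *\<^sub>C d *\<^sub>C f = (c * d) *\<^sub>C f"
    by (rule blinfun_eqI) (simp add: scaleC_blinfun_apply scaleC_scaleC)
  show "complex_of_real r *\<^sub>C f = r *\<^sub>R f"
    by (rule blinfun_eqI) (simp add: scaleC_blinfun_apply blinfun.scaleR_left scaleC_of_real)
  have le: "norm (c *\<^sub>C f) \<le> cmod c * norm f" for c :: complex and f :: "'a \<Rightarrow>\<^sub>L 'b"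
    by (rule norm_blinfun_bound)
      (auto simp: scaleC_blinfun_apply norm_scaleC mult.assoc intro!: mult_left_mono norm_blinfun)
  show "norm (c *\<^sub>C f) = cmod c * norm f"
  proof (cases "c = 0")
    case True
    then show ?thesis using le[of 0 f] by simp
  next
    case False
    have "inverse c *\<^sub>C (c *\<^sub>C f) = f"
      using False scaleC_of_real[of 1]
      by (intro blinfun_eqI) (simp add: scaleC_blinfun_apply scaleC_scaleC)
    then have "norm f \<le> inverse (cmod c) * norm (c *\<^sub>C f)"
      using le[of "inverse c" "c *\<^sub>C f"] by (simp add: norm_inverse)
    then show ?thesis using le[of c f] False by (simp add: field_simps)
  qed
qed
end

text \<open>Operators \<^typ>\<open>'a \<Rightarrow>\<^sub>L 'b\<close> are only real-linear in general.\<close>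

definition complex_linear :: "('a::complex_normed \<Rightarrow>\<^sub>L 'b::complex_normed) \<Rightarrow> bool" where
  "complex_linear f \<longleftrightarrow> (\<forall>c x. blinfun_apply f (c *\<^sub>C x) = c *\<^sub>C blinfun_apply f x)"

definition holomorphic_map_on ::
    "(complex^'n) set \<Rightarrow> (complex^'n \<Rightarrow> 'b::complex_normed) \<Rightarrow> bool" where
  "holomorphic_map_on U f \<longleftrightarrow>
     (\<forall>x\<in>U. \<exists>L. (f has_derivative L) (at x) \<and> (\<forall>c v. L (c *s v) = c *\<^sub>C L v))"


section \<open>Hilbert tensor powers\<close>

definition c_orthonormal :: "'h::complex_hilbert set \<Rightarrow> bool" where
  "c_orthonormal A \<longleftrightarrow> (\<forall>a\<in>A. \<forall>b\<in>A. cinner a b = (if a = b then 1 else 0))"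

definition conj_multilinear :: "('h::complex_hilbert list \<Rightarrow> complex) \<Rightarrow> bool" where
  "conj_multilinear T \<longleftrightarrow>
     (\<forall>us v w ws. T (us @ (v + w) # ws) = T (us @ v # ws) + T (us @ w # ws)) \<and>
     (\<forall>us c v ws. T (us @ (c *\<^sub>C v) # ws) = cnj c * T (us @ v # ws))"

definition lists_upto :: "'a set \<Rightarrow> nat \<Rightarrow> 'a list set" where
  "lists_upto A N = {ws. set ws \<subseteq> A \<and> length ws \<le> N}"

definition finite_orthonormal :: "('h::complex_hilbert set \<times> nat) set" where
  "finite_orthonormal = {(A, N). finite A \<and> c_orthonormal A}"

definition hs_partial :: "('h::complex_hilbert list \<Rightarrow> complex) \<Rightarrow> 'h set \<times> nat \<Rightarrow> real" where
  "hs_partial T = (\<lambda>(A, N). L2_set (\<lambda>ws. cmod (T ws)) (lists_upto A N))"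

text \<open>As in Kadison and Ringrose, the \<open>m\<close>-th Hilbert tensor power of \<open>H\<close> is the space of
  Hilbert-Schmidt conjugate-multilinear functionals \<open>T\<close> of \<open>m\<close> vectors in \<open>H\<close>, where
  \<open>T [w\<^sub>1, \<dots>, w\<^sub>m]\<close> is the inner product of \<open>T\<close> with \<open>w\<^sub>1 \<otimes> \<dots> \<otimes> w\<^sub>m\<close>, that is, the value on \<open>T\<close> of
  \<open>\<langle>\<cdot>, w\<^sub>1\<rangle> \<otimes> \<dots> \<otimes> \<langle>\<cdot>, w\<^sub>m\<rangle>\<close>. All degrees are collected in one type (the full Fock space), because a
  type cannot depend on \<open>m\<close>.\<close>

typedef (overloaded) 'h tensor =
  "{T :: 'h::complex_hilbert list \<Rightarrow> complex.
      conj_multilinear T \<and> bdd_above (hs_partial T ` finite_orthonormal)}"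
  morphisms tensor_apply Abs_tensor
proof
  show "(\<lambda>_. 0) \<in> {T :: 'h list \<Rightarrow> complex.
      conj_multilinear T \<and> bdd_above (hs_partial T ` finite_orthonormal)}"
    by (auto simp: conj_multilinear_def hs_partial_def L2_set_def intro!: bdd_aboveI[of _ 0])
qed

setup_lifting type_definition_tensor

definition tensor_power :: "nat \<Rightarrow> 'h::complex_hilbert tensor set" where
  "tensor_power m = {T. \<forall>ws. length ws \<noteq> m \<longrightarrow> tensor_apply T ws = 0}"

lemma hs_partial_nonneg: "0 \<le> hs_partial T X"
  by (cases X) (simp add: hs_partial_def)

lemma hs_partial_add: "hs_partial (\<lambda>ws. S ws + T ws) X \<le> hs_partial S X + hs_partial T X"
proof (cases X)
  case (Pair A N)
  have "L2_set (\<lambda>ws. cmod (S ws + T ws)) (lists_upto A N)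
      \<le> L2_set (\<lambda>ws. cmod (S ws) + cmod (T ws)) (lists_upto A N)"
    by (intro L2_set_mono norm_triangle_ineq) auto
  also have "\<dots> \<le> L2_set (\<lambda>ws. cmod (S ws)) (lists_upto A N)
      + L2_set (\<lambda>ws. cmod (T ws)) (lists_upto A N)"
    by (rule L2_set_triangle_ineq)
  finally show ?thesis by (simp add: Pair hs_partial_def)
qed

lemma hs_partial_scale: "hs_partial (\<lambda>ws. c * T ws) X = cmod c * hs_partial T X"
  by (cases X) (simp add: hs_partial_def norm_mult L2_set_right_distrib)

lemma finite_orthonormal_nonempty: "finite_orthonormal \<noteq> {}"
  by (auto simp: finite_orthonormal_def c_orthonormal_def intro!: exI[of _ "{}"])

lemma finite_lists_upto: "finite A \<Longrightarrow> finite (lists_upto A N)"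
  unfolding lists_upto_def by (rule finite_lists_length_le)

instantiation tensor :: (complex_hilbert) complex_normed
begin

lift_definition zero_tensor :: "'a tensor" is "\<lambda>_. 0"
  by (auto simp: conj_multilinear_def hs_partial_def L2_set_def intro!: bdd_aboveI[of _ 0])

lift_definition plus_tensor :: "'a tensor \<Rightarrow> 'a tensor \<Rightarrow> 'a tensor" is "\<lambda>S T ws. S ws + T ws"
proof -
  fix S T :: "'a list \<Rightarrow> complex"
  assume S: "conj_multilinear S \<and> bdd_above (hs_partial S ` finite_orthonormal)"
    and T: "conj_multilinear T \<and> bdd_above (hs_partial T ` finite_orthonormal)"
  then obtain B C where B: "\<And>X. X \<in> finite_orthonormal \<Longrightarrow> hs_partial S X \<le> B"
    and C: "\<And>X. X \<in> finite_orthonormal \<Longrightarrow> hs_partial T X \<le> C"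
    unfolding bdd_above_def by blast
  have "bdd_above (hs_partial (\<lambda>ws. S ws + T ws) ` finite_orthonormal)"
    by (rule bdd_aboveI2[of _ _ "B + C"], rule order_trans[OF hs_partial_add])
      (intro add_mono B C)
  moreover have "conj_multilinear (\<lambda>ws. S ws + T ws)"
    using S T by (simp add: conj_multilinear_def algebra_simps)
  ultimately show "conj_multilinear (\<lambda>ws. S ws + T ws) \<and>
      bdd_above (hs_partial (\<lambda>ws. S ws + T ws) ` finite_orthonormal)" by blast
qed

lift_definition scaleC_tensor :: "complex \<Rightarrow> 'a tensor \<Rightarrow> 'a tensor" is "\<lambda>c T ws. c * T ws"
proof -
  fix c and T :: "'a list \<Rightarrow> complex"
  assume T: "conj_multilinear T \<and> bdd_above (hs_partial T ` finite_orthonormal)"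
  then obtain C where C: "\<And>X. X \<in> finite_orthonormal \<Longrightarrow> hs_partial T X \<le> C"
    unfolding bdd_above_def by blast
  have "bdd_above (hs_partial (\<lambda>ws. c * T ws) ` finite_orthonormal)"
    by (rule bdd_aboveI2[of _ _ "cmod c * C"])
      (auto simp: hs_partial_scale intro!: mult_left_mono C)
  moreover have "conj_multilinear (\<lambda>ws. c * T ws)"
    using T by (simp add: conj_multilinear_def algebra_simps)
  ultimately show "conj_multilinear (\<lambda>ws. c * T ws) \<and>
      bdd_above (hs_partial (\<lambda>ws. c * T ws) ` finite_orthonormal)" by blast
qed

definition scaleR_tensor :: "real \<Rightarrow> 'a tensor \<Rightarrow> 'a tensor"
  where "scaleR_tensor r T = complex_of_real r *\<^sub>C T"

definition uminus_tensor :: "'a tensor \<Rightarrow> 'a tensor"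
  where "uminus_tensor T = (- 1) *\<^sub>C T"

definition minus_tensor :: "'a tensor \<Rightarrow> 'a tensor \<Rightarrow> 'a tensor"
  where "minus_tensor S T = S + (- T)"

definition norm_tensor :: "'a tensor \<Rightarrow> real"
  where "norm_tensor T = (SUP X\<in>finite_orthonormal. hs_partial (tensor_apply T) X)"

definition sgn_tensor :: "'a tensor \<Rightarrow> 'a tensor"
  where "sgn_tensor T = inverse (norm T) *\<^sub>R T"

definition dist_tensor :: "'a tensor \<Rightarrow> 'a tensor \<Rightarrow> real"
  where "dist_tensor S T = norm (S - T)"

definition uniformity_tensor :: "('a tensor \<times> 'a tensor) filter"
  where "uniformity_tensor = (INF e\<in>{0<..}. principal {(S, T). dist S T < e})"

definition open_tensor :: "'a tensor set \<Rightarrow> bool"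
  where "open_tensor U \<longleftrightarrow> (\<forall>S\<in>U. eventually (\<lambda>(S', T). S' = S \<longrightarrow> T \<in> U) uniformity)"

lemma hs_partial_le_norm: "X \<in> finite_orthonormal \<Longrightarrow> hs_partial (tensor_apply T) X \<le> norm T"
  unfolding norm_tensor_def using tensor_apply[of T] by (auto intro: cSUP_upper)

lemma norm_tensor_le:
  "(\<And>X. X \<in> finite_orthonormal \<Longrightarrow> hs_partial (tensor_apply T) X \<le> B) \<Longrightarrow> norm T \<le> B"
  unfolding norm_tensor_def by (rule cSUP_least[OF finite_orthonormal_nonempty])

lemma scaleC_one_hilbert: "1 *\<^sub>C (x :: 'a) = x"
  using scaleC_of_real[of 1 x] by simp

lemma cinner_zero_left: "cinner 0 (x :: 'a) = 0"
  using cinner_add_left[of 0 0 x] by simp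

lemma cinner_minus_left: "cinner (x - y) (z :: 'a) = cinner x z - cinner y z"
  using cinner_add_left[of "x - y" y z] by simp

lemma cinner_sum_left: "cinner (\<Sum>a\<in>A. f a) (z :: 'a) = (\<Sum>a\<in>A. cinner (f a) z)"
  by (induction A rule: infinite_finite_induct) (auto simp: cinner_zero_left cinner_add_left)

lemma orthonormal_spanning:
  fixes S :: "'a set"
  assumes "finite S"
  shows "\<exists>A. finite A \<and> c_orthonormal A \<and> (\<forall>s\<in>S. s = (\<Sum>a\<in>A. cinner s a *\<^sub>C a))"
  using assms
proof (induction S)
  case empty
  then show ?case by (auto simp: c_orthonormal_def intro!: exI[of _ "{}"])
next
  case (insert w S)
  then obtain A where A: "finite A" "c_orthonormal A" "\<forall>s\<in>S. s = (\<Sum>a\<in>A. cinner s a *\<^sub>C a)"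
    by blast
  define r where "r = w - (\<Sum>a\<in>A. cinner w a *\<^sub>C a)"
  have orth: "cinner r b = 0" if "b \<in> A" for b
  proof -
    have "(\<Sum>a\<in>A. cinner (cinner w a *\<^sub>C a) b) = (\<Sum>a\<in>A. if a = b then cinner w b else 0)"
      using A(2) that
      by (intro sum.cong) (auto simp: cinner_scaleC_left c_orthonormal_def)
    then show ?thesis using that A(1) by (simp add: r_def cinner_minus_left cinner_sum_left)
  qed
  show ?case
  proof (cases "r = 0")
    case True
    then show ?thesis using A by (intro exI[of _ A]) (auto simp: r_def)
  next
    case False
    define e where "e = complex_of_real (inverse (norm r)) *\<^sub>C r"
    have orth': "cinner b r = 0" if "b \<in> A" for b
      using orth[OF that] cinner_commute[of b r] by simp
    have rr: "cinner r r = complex_of_real ((norm r)\<^sup>2)"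
    proof -
      have "Im (cinner r r) = 0"
        using cinner_commute[of r r] by (metis add.inverse_neutral cnj.simps(2) equation_minus_iff
            neg_equal_zero)
      then show ?thesis
        by (simp add: complex_eq_iff Re_cinner power2_norm_eq_inner)
    qed
    have re: "cinner x e = complex_of_real (inverse (norm r)) * cinner x r" for x
      using cinner_commute[of x e] cinner_commute[of x r]
      by (simp add: e_def cinner_scaleC_left)
    have ee: "cinner e e = 1"
      using False unfolding re
      by (simp add: e_def cinner_scaleC_left rr power2_eq_square field_simps)
    have ae: "cinner a e = 0" "cinner e a = 0" if "a \<in> A" for a
      using orth'[OF that] orth[OF that] re[of a]
      by (simp_all add: e_def cinner_scaleC_left del: of_real_inverse)
    have "e \<notin> A" using ae ee by force
    have on: "c_orthonormal (insert e A)"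
      using A(2) ae ee \<open>e \<notin> A\<close> by (auto simp: c_orthonormal_def)
    have "cinner w e *\<^sub>C e = r"
    proof -
      have "cinner (\<Sum>a\<in>A. cinner w a *\<^sub>C a) e = 0"
        by (simp add: cinner_sum_left cinner_scaleC_left ae)
      then have "cinner w e = cinner r e"
        using cinner_minus_left[of w "\<Sum>a\<in>A. cinner w a *\<^sub>C a" e] by (simp add: r_def)
      also have "\<dots> = complex_of_real (norm r)"
        unfolding re rr using False by (simp add: power2_eq_square)
      finally show ?thesis
        using False by (simp add: e_def scaleC_scaleC scaleC_one_hilbert flip: of_real_mult)
    qed
    then have "w = (\<Sum>a\<in>insert e A. cinner w a *\<^sub>C a)"
      using A(1) \<open>e \<notin> A\<close> by (simp add: r_def)
    moreover have "s = (\<Sum>a\<in>insert e A. cinner s a *\<^sub>C a)" if "s \<in> S" for s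
    proof -
      have "cinner s e = (\<Sum>a\<in>A. cinner (cinner s a *\<^sub>C a) e)"
        using A(3) that cinner_sum_left by metis
      also have "\<dots> = 0" by (simp add: cinner_scaleC_left ae)
      finally show ?thesis
        using A(1,3) that \<open>e \<notin> A\<close> scaleC_of_real[of 0 e] by simp
    qed
    ultimately show ?thesis using on A(1) by (intro exI[of _ "insert e A"]) auto
  qed
qed

lemma conj_multilinear_sum:
  fixes T :: "'a list \<Rightarrow> complex"
  assumes "conj_multilinear T" "finite A"
  shows "T (us @ (\<Sum>a\<in>A. c a *\<^sub>C a) # ws) = (\<Sum>a\<in>A. cnj (c a) * T (us @ a # ws))"
  using assms(2)
proof (induction A)
  case empty
  have "T (us @ (0 *\<^sub>C 0) # ws) = cnj 0 * T (us @ 0 # ws)"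
    using assms(1) unfolding conj_multilinear_def by blast
  then show ?case using scaleC_of_real[of 0 "0 :: 'a"] by simp
next
  case (insert b A)
  then show ?case using assms(1) unfolding conj_multilinear_def by simp
qed

lemma norm_tensor_eq_0D:
  assumes "norm (T :: 'a tensor) = 0"
  shows "T = 0"
proof -
  have "tensor_apply T ws = 0" for ws
  proof -
    obtain A where A: "finite A" "c_orthonormal A" "\<forall>s\<in>set ws. s = (\<Sum>a\<in>A. cinner s a *\<^sub>C a)"
      using orthonormal_spanning[of "set ws"] by auto
    have ml: "conj_multilinear (tensor_apply T)" using tensor_apply[of T] by simp
    have zero: "tensor_apply T us = 0" if "set us \<subseteq> A" for us
    proof -
      have "hs_partial (tensor_apply T) (A, length us) \<le> 0"
        using hs_partial_le_norm[of "(A, length us)" T] A assms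
        by (simp add: finite_orthonormal_def)
      then have "L2_set (\<lambda>ws. cmod (tensor_apply T ws)) (lists_upto A (length us)) = 0"
        by (simp add: hs_partial_def L2_set_nonneg order_antisym)
      then show ?thesis
        using that finite_lists_upto[OF A(1)] by (auto simp: L2_set_eq_0_iff lists_upto_def)
    qed
    have "set us \<subseteq> A \<Longrightarrow> \<forall>s\<in>set vs. s = (\<Sum>a\<in>A. cinner s a *\<^sub>C a) \<Longrightarrow>
        tensor_apply T (us @ vs) = 0" for us vs
    proof (induction vs arbitrary: us)
      case Nil
      then show ?case using zero by simp
    next
      case (Cons v vs)
      have "tensor_apply T (us @ v # vs)
          = (\<Sum>a\<in>A. cnj (cinner v a) * tensor_apply T (us @ a # vs))"
        using conj_multilinear_sum[OF ml A(1), of us "cinner v" vs] Cons.prems(2) by simp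
      moreover have "tensor_apply T (us @ a # vs) = 0" if "a \<in> A" for a
        using Cons.IH[of "us @ [a]"] Cons.prems that by simp
      ultimately show ?case by simp
    qed
    then show ?thesis using A(3) by (metis append_Nil empty_set empty_subsetI)
  qed
  then show ?thesis by (simp add: tensor_apply_inject[symmetric] zero_tensor.rep_eq fun_eq_iff)
qed

instance
proof
  fix R S T :: "'a tensor" and r q :: real and c d :: complex
  show "dist S T = norm (S - T)" by (rule dist_tensor_def)
  show "sgn T = inverse (norm T) *\<^sub>R T" by (rule sgn_tensor_def)
  show "(uniformity :: ('a tensor \<times> 'a tensor) filter)
      = (INF e\<in>{0<..}. principal {(S, T). dist S T < e})"
    by (rule uniformity_tensor_def)
  show "open U \<longleftrightarrow> (\<forall>S\<in>U. eventually (\<lambda>(S', T). S' = S \<longrightarrow> T \<in> U) uniformity)"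
    for U :: "'a tensor set" by (rule open_tensor_def)
  show "R + S + T = R + (S + T)" by transfer (simp add: add.assoc)
  show "S + T = T + S" by transfer (simp add: add.commute)
  show "0 + T = T" by transfer simp
  show "- T + T = 0" unfolding uminus_tensor_def by transfer simp
  show "S - T = S + - T" by (rule minus_tensor_def)
  show "r *\<^sub>R (S + T) = r *\<^sub>R S + r *\<^sub>R T"
    unfolding scaleR_tensor_def by transfer (simp add: algebra_simps)
  show "(r + q) *\<^sub>R T = r *\<^sub>R T + q *\<^sub>R T"
    unfolding scaleR_tensor_def by transfer (simp add: algebra_simps)
  show "r *\<^sub>R q *\<^sub>R T = (r * q) *\<^sub>R T" unfolding scaleR_tensor_def by transfer (simp add: mult.assoc)
  show "1 *\<^sub>R T = T" unfolding scaleR_tensor_def by transfer simp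
  show "c *\<^sub>C (S + T) = c *\<^sub>C S + c *\<^sub>C T" by transfer (simp add: algebra_simps)
  show "(c + d) *\<^sub>C T = c *\<^sub>C T + d *\<^sub>C T" by transfer (simp add: algebra_simps)
  show "c *\<^sub>C d *\<^sub>C T = (c * d) *\<^sub>C T" by transfer (simp add: mult.assoc)
  show "complex_of_real r *\<^sub>C T = r *\<^sub>R T" by (simp add: scaleR_tensor_def)
  show "norm (S + T) \<le> norm S + norm T"
    by (rule norm_tensor_le, unfold plus_tensor.rep_eq, rule order_trans[OF hs_partial_add])
      (intro add_mono hs_partial_le_norm)
  show normC: "norm (c *\<^sub>C T) = cmod c * norm T" for c and T :: "'a tensor"
  proof -
    have le: "norm (c *\<^sub>C T) \<le> cmod c * norm T" for c and T :: "'a tensor"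
      by (rule norm_tensor_le)
        (auto simp: scaleC_tensor.rep_eq hs_partial_scale intro!: mult_left_mono hs_partial_le_norm)
    have nonneg: "0 \<le> norm T" for T :: "'a tensor"
      using finite_orthonormal_nonempty hs_partial_nonneg hs_partial_le_norm order_trans
      by (metis ex_in_conv)
    show ?thesis
    proof (cases "c = 0")
      case True
      then show ?thesis using le[of c T] nonneg[of "c *\<^sub>C T"] by simp
    next
      case False
      have "inverse c *\<^sub>C c *\<^sub>C T = T" using False by transfer (simp add: mult.assoc[symmetric])
      then have "norm T \<le> inverse (cmod c) * norm (c *\<^sub>C T)"
        using le[of "inverse c" "c *\<^sub>C T"] by (simp add: norm_inverse)
      then show ?thesis using le[of c T] False by (simp add: field_simps)
    qed
  qed
  show "norm (r *\<^sub>R T) = \<bar>r\<bar> * norm T" by (simp add: scaleR_tensor_def normC)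
  have "norm (0 *\<^sub>C T) = 0" by (simp add: normC)
  moreover have "0 *\<^sub>C T = 0" by transfer simp
  ultimately show "norm T = 0 \<longleftrightarrow> T = 0" using norm_tensor_eq_0D by auto
qed

end


section \<open>Holomorphic vector bundles\<close>

text \<open>The total space over \<open>D\<close> is \<open>proj E -` D\<close>. An element \<open>(U, \<phi>)\<close> of the atlas is a trivialization
  \<open>v \<mapsto> (proj E v, \<phi> v)\<close> of the part over \<open>U\<close>; the vector space and topological structure of the fibres
  and the complex structure of the total space are those for which the trivializations are
  isomorphisms.\<close>

record ('x, 'e, 'h) vbundle =
  proj :: "'e \<Rightarrow> 'x"
  atlas :: "('x set \<times> ('e \<Rightarrow> 'h)) set"

definition fibre :: "('x, 'e, 'h) vbundle \<Rightarrow> 'x \<Rightarrow> 'e set" where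
  "fibre E x = {v. proj E v = x}"

definition holomorphic_vector_bundle ::
    "(complex^'n) set \<Rightarrow> (complex^'n, 'e, 'h::complex_hilbert) vbundle \<Rightarrow> bool" where
  "holomorphic_vector_bundle D E \<longleftrightarrow>
     (\<Union>(U, \<phi>)\<in>atlas E. U) = D \<and>
     (\<forall>(U, \<phi>)\<in>atlas E. open U \<and> (\<forall>x\<in>U. bij_betw \<phi> (fibre E x) UNIV)) \<and>
     (\<forall>(U, \<phi>)\<in>atlas E. \<forall>(V, \<psi>)\<in>atlas E.
        \<exists>g :: complex^'n \<Rightarrow> 'h \<Rightarrow>\<^sub>L 'h. holomorphic_map_on (U \<inter> V) g \<and>
          (\<forall>x\<in>U \<inter> V. complex_linear (g x) \<and>
             (\<forall>v\<in>fibre E x. \<psi> v = blinfun_apply (g x) (\<phi> v))))"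

definition fibre_scale :: "('x, 'e, 'h::complex_hilbert) vbundle \<Rightarrow> complex \<Rightarrow> 'e \<Rightarrow> 'e" where
  "fibre_scale E c v = (THE w. w \<in> fibre E (proj E v) \<and>
     (\<forall>(U, \<phi>)\<in>atlas E. proj E v \<in> U \<longrightarrow> \<phi> w = c *\<^sub>C \<phi> v))"

abbreviation is_fibre_zero :: "('x, 'e, 'h::complex_hilbert) vbundle \<Rightarrow> 'e \<Rightarrow> bool" where
  "is_fibre_zero E v \<equiv> fibre_scale E 0 v = v"


subsection \<open>The dual bundle\<close>

text \<open>Fibres of the dual bundle consist of the continuous linear functionals on the fibres of \<open>E\<close>.\<close>

definition dual_fibre ::
    "('x, 'e, 'h::complex_hilbert) vbundle \<Rightarrow> 'x \<Rightarrow> ('e \<Rightarrow> complex) set" where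
  "dual_fibre E x = {\<xi> \<in> extensional (fibre E x). \<forall>(U, \<phi>)\<in>atlas E. x \<in> U \<longrightarrow>
     (\<exists>l :: 'h \<Rightarrow>\<^sub>L complex. complex_linear l \<and> (\<forall>v\<in>fibre E x. \<xi> v = blinfun_apply l (\<phi> v)))}"

definition holomorphic_dual_section :: "(complex^'n, 'e, 'h::complex_hilbert) vbundle \<Rightarrow>
    (complex^'n) set \<Rightarrow> (complex^'n \<Rightarrow> 'e \<Rightarrow> complex) \<Rightarrow> bool" where
  "holomorphic_dual_section E W s \<longleftrightarrow>
     (\<forall>x\<in>W. s x \<in> dual_fibre E x) \<and>
     (\<forall>(U, \<phi>)\<in>atlas E. \<exists>l :: complex^'n \<Rightarrow> 'h \<Rightarrow>\<^sub>L complex. holomorphic_map_on (U \<inter> W) l \<and>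
        (\<forall>x\<in>U \<inter> W. complex_linear (l x) \<and> (\<forall>v\<in>fibre E x. s x v = blinfun_apply (l x) (\<phi> v))))"


subsection \<open>Tensor powers of a bundle\<close>

text \<open>An element of the fibre of the \<open>m\<close>-th tensor power at \<open>x\<close> is given by its values \<open>t [\<xi>\<^sub>1, \<dots>, \<xi>\<^sub>m]\<close>
  on \<open>\<xi>\<^sub>1 \<otimes> \<dots> \<otimes> \<xi>\<^sub>m\<close> for \<open>\<xi>\<^sub>i\<close> in the dual fibre. In a trivialization \<open>\<phi>\<close> it becomes the element of the
  Hilbert tensor power of the model space whose value at \<open>[w\<^sub>1, \<dots>, w\<^sub>m]\<close> is obtained with
  \<open>\<xi>\<^sub>i = \<langle>\<phi> \<cdot>, w\<^sub>i\<rangle>\<close>.\<close>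

definition dual_lists ::
    "('x, 'e, 'h::complex_hilbert) vbundle \<Rightarrow> nat \<Rightarrow> 'x \<Rightarrow> ('e \<Rightarrow> complex) list set" where
  "dual_lists E m x = {\<xi>s. length \<xi>s = m \<and> set \<xi>s \<subseteq> dual_fibre E x}"

definition frame_dual ::
    "('x, 'e, 'h::complex_hilbert) vbundle \<Rightarrow> 'x \<Rightarrow> ('e \<Rightarrow> 'h) \<Rightarrow> 'h \<Rightarrow> 'e \<Rightarrow> complex" where
  "frame_dual E x \<phi> w = (\<lambda>v\<in>fibre E x. cinner (\<phi> v) w)"

definition represents :: "('x, 'e, 'h::complex_hilbert) vbundle \<Rightarrow> nat \<Rightarrow> 'x \<Rightarrow> ('e \<Rightarrow> 'h) \<Rightarrow>
    'h tensor \<Rightarrow> (('e \<Rightarrow> complex) list \<Rightarrow> complex) \<Rightarrow> bool" where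
  "represents E m x \<phi> T t \<longleftrightarrow> T \<in> tensor_power m \<and>
     (\<forall>ws. length ws = m \<longrightarrow> t (map (frame_dual E x \<phi>) ws) = tensor_apply T ws)"

definition tensor_fibre :: "('x, 'e, 'h::complex_hilbert) vbundle \<Rightarrow> nat \<Rightarrow> 'x \<Rightarrow>
    (('e \<Rightarrow> complex) list \<Rightarrow> complex) set" where
  "tensor_fibre E m x = {t \<in> extensional (dual_lists E m x).
     \<forall>(U, \<phi>)\<in>atlas E. x \<in> U \<longrightarrow> (\<exists>T. represents E m x \<phi> T t)}"

definition tensor_pow :: "('x, 'e, 'h::complex_hilbert) vbundle \<Rightarrow> nat \<Rightarrow> 'e \<Rightarrow>
    ('e \<Rightarrow> complex) list \<Rightarrow> complex" where
  "tensor_pow E m a = (\<lambda>\<xi>s\<in>dual_lists E m (proj E a). \<Prod>\<xi>\<leftarrow>\<xi>s. \<xi> a)"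

definition holomorphic_tensor_section :: "(complex^'n, 'e, 'h::complex_hilbert) vbundle \<Rightarrow>
    nat \<Rightarrow> (complex^'n) set \<Rightarrow> (complex^'n \<Rightarrow> ('e \<Rightarrow> complex) list \<Rightarrow> complex) \<Rightarrow> bool" where
  "holomorphic_tensor_section E m W f \<longleftrightarrow>
     (\<forall>x\<in>W. f x \<in> tensor_fibre E m x) \<and>
     (\<forall>(U, \<phi>)\<in>atlas E. \<exists>F :: complex^'n \<Rightarrow> 'h tensor. holomorphic_map_on (U \<inter> W) F \<and>
        (\<forall>x\<in>U \<inter> W. represents E m x \<phi> (F x) (f x)))"


section \<open>Finsler metrics\<close>

text \<open>Metrics take the squared length as their value, so that \<open>0 * \<infinity> = 0\<close> in the homogeneity
  condition makes the zero vector have length zero.\<close>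

definition enn_powr :: "ennreal \<Rightarrow> real \<Rightarrow> ennreal" where
  "enn_powr y p = (if y = \<infinity> then \<infinity> else ennreal (enn2real y powr p))"

definition len :: "('a \<Rightarrow> ennreal) \<Rightarrow> 'a \<Rightarrow> ennreal" where
  "len h v = enn_powr (h v) (1/2)"

definition singular_finsler_metric ::
    "'x set \<Rightarrow> ('x, 'e, 'h::complex_hilbert) vbundle \<Rightarrow> ('e \<Rightarrow> ennreal) \<Rightarrow> bool" where
  "singular_finsler_metric D E h \<longleftrightarrow>
     (\<forall>x\<in>D. \<forall>v\<in>fibre E x. \<forall>c. h (fibre_scale E c v) = ennreal ((cmod c)\<^sup>2) * h v)"

definition dual_len :: "('x, 'e, 'h::complex_hilbert) vbundle \<Rightarrow> ('e \<Rightarrow> ennreal) \<Rightarrow> 'x \<Rightarrow>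
    ('e \<Rightarrow> complex) \<Rightarrow> ennreal" where
  "dual_len E h x \<xi> =
     (if \<forall>v\<in>fibre E x. \<not> is_fibre_zero E v \<longrightarrow> len h v = \<infinity> then 0
      else SUP v\<in>{v \<in> fibre E x. len h v \<le> 1}. ennreal (cmod (\<xi> v)))"


subsection \<open>The induced metric on tensor powers\<close>

text \<open>\<open>b\<close> is a (bounded) Hermitian inner product on the fibre at \<open>x\<close>.\<close>

definition hermitian_form :: "('x, 'e, 'h::complex_hilbert) vbundle \<Rightarrow> 'x \<Rightarrow>
    ('e \<Rightarrow> 'e \<Rightarrow> complex) \<Rightarrow> bool" where
  "hermitian_form E x b \<longleftrightarrow>
     (\<forall>v\<in>fibre E x. \<forall>a\<in>fibre E x. b a v = cnj (b v a)) \<and>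
     (\<forall>a\<in>fibre E x. (\<lambda>v\<in>fibre E x. b v a) \<in> dual_fibre E x) \<and>
     (\<forall>v\<in>fibre E x. \<not> is_fibre_zero E v \<longrightarrow> 0 < Re (b v v))"

text \<open>The squared length of a tensor with respect to the tensor power of \<open>b\<close>: the sum of the squared
  moduli of its components in a \<open>b\<close>-orthonormal basis.\<close>

definition hermitian_tensor_sq :: "('x, 'e, 'h::complex_hilbert) vbundle \<Rightarrow> nat \<Rightarrow> 'x \<Rightarrow>
    ('e \<Rightarrow> 'e \<Rightarrow> complex) \<Rightarrow> (('e \<Rightarrow> complex) list \<Rightarrow> complex) \<Rightarrow> ennreal" where
  "hermitian_tensor_sq E m x b t =
     (SUP A\<in>{A. finite A \<and> A \<subseteq> fibre E x \<and> (\<forall>a\<in>A. \<forall>a'\<in>A. b a a' = (if a = a' then 1 else 0))}.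
        \<Sum>as\<in>{as. set as \<subseteq> A \<and> length as = m}.
          ennreal ((cmod (t (map (\<lambda>a. \<lambda>v\<in>fibre E x. b v a) as)))\<^sup>2))"

text \<open>\<open>k x\<close> is (the square of) a Finsler metric on the fibre at \<open>x\<close> of the \<open>m\<close>-th tensor power.
  For a general Finsler metric \<open>h\<close> the induced metric is only required to satisfy the duality
  inequality; for a Hermitian \<open>h\<close> it is the usual one.\<close>

definition induced_tensor_metric ::
    "'x set \<Rightarrow> ('x, 'e, 'h::complex_hilbert) vbundle \<Rightarrow> ('e \<Rightarrow> ennreal) \<Rightarrow> nat \<Rightarrow>
     ('x \<Rightarrow> (('e \<Rightarrow> complex) list \<Rightarrow> complex) \<Rightarrow> ennreal) \<Rightarrow> bool" where
  "induced_tensor_metric D E h m k \<longleftrightarrow>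
     (\<forall>x\<in>D. \<forall>t\<in>tensor_fibre E m x. \<forall>c.
        k x (\<lambda>\<xi>s\<in>dual_lists E m x. c * t \<xi>s) = ennreal ((cmod c)\<^sup>2) * k x t) \<and>
     (\<forall>x\<in>D. \<forall>u\<in>dual_fibre E x. \<forall>t\<in>tensor_fibre E m x.
        \<not> (dual_len E h x u ^ m = 0 \<and> len (k x) t = \<infinity>) \<longrightarrow>
        \<not> (dual_len E h x u ^ m = \<infinity> \<and> len (k x) t = 0) \<longrightarrow>
        ennreal (cmod (t (replicate m u))) \<le> dual_len E h x u ^ m * len (k x) t) \<and>
     (\<forall>b. (\<forall>x\<in>D. hermitian_form E x (b x) \<and> (\<forall>v\<in>fibre E x. h v = ennreal (Re (b x v v)))) \<longrightarrow>
        (\<forall>x\<in>D. \<forall>t\<in>tensor_fibre E m x. k x t = hermitian_tensor_sq E m x (b x) t))"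

definition multiple_coarse_Lp_extension ::
    "(complex^'n) set \<Rightarrow> (complex^'n, 'e, 'h::complex_hilbert) vbundle \<Rightarrow> ('e \<Rightarrow> ennreal) \<Rightarrow>
     (nat \<Rightarrow> complex^'n \<Rightarrow> (('e \<Rightarrow> complex) list \<Rightarrow> complex) \<Rightarrow> ennreal) \<Rightarrow> real \<Rightarrow> bool" where
  "multiple_coarse_Lp_extension D E h k p \<longleftrightarrow>
     (\<exists>C :: nat \<Rightarrow> real. (\<forall>m\<ge>1. 0 < C m) \<and> (\<lambda>m. ln (C m) / real m) \<longlonglongrightarrow> 0 \<and>
        (\<forall>z\<in>D. \<forall>a\<in>fibre E z. len h a = 1 \<longrightarrow>
           (\<forall>m\<ge>1. \<exists>f. holomorphic_tensor_section E m D f \<and> f z = tensor_pow E m a \<and>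
              (\<integral>\<^sup>+x\<in>D. enn_powr (len (k m x) (f x)) p \<partial>lebesgue) \<le> ennreal (C m))))"


section \<open>Plurisubharmonicity and Griffiths semi-positivity\<close>

text \<open>As usual in potential theory, an upper semicontinuous function does not take the value \<open>+\<infinity>\<close>.\<close>

definition usc_on :: "'x::topological_space set \<Rightarrow> ('x \<Rightarrow> 'b::{linorder,order_top}) \<Rightarrow> bool" where
  "usc_on U u \<longleftrightarrow> (\<forall>x\<in>U. u x < top) \<and> (\<forall>c. openin (top_of_set U) {x \<in> U. u x < c})"

text \<open>The mean over \<open>[0, 2\<pi>]\<close> of a function that is bounded above, so that the integral of its
  positive part is finite.\<close>

definition circle_mean :: "(real \<Rightarrow> ereal) \<Rightarrow> ereal" where
  "circle_mean v =
     (enn2ereal (\<integral>\<^sup>+\<theta>\<in>{0..2*pi}. e2ennreal (v \<theta>) \<partial>lborel)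
      - enn2ereal (\<integral>\<^sup>+\<theta>\<in>{0..2*pi}. e2ennreal (- v \<theta>) \<partial>lborel)) / ereal (2 * pi)"

definition plurisubharmonic_on :: "(complex^'n) set \<Rightarrow> (complex^'n \<Rightarrow> ereal) \<Rightarrow> bool" where
  "plurisubharmonic_on U u \<longleftrightarrow> usc_on U u \<and>
     (\<forall>a w. (\<forall>\<zeta>. cmod \<zeta> \<le> 1 \<longrightarrow> a + \<zeta> *s w \<in> U) \<longrightarrow>
        u a \<le> circle_mean (\<lambda>\<theta>. u (a + cis \<theta> *s w)))"

definition enn_ln :: "ennreal \<Rightarrow> ereal" where
  "enn_ln y = (if y = 0 then - \<infinity> else if y = \<infinity> then \<infinity> else ereal (ln (enn2real y)))"

definition griffiths_semipositive ::
    "(complex^'n) set \<Rightarrow> (complex^'n, 'e, 'h::complex_hilbert) vbundle \<Rightarrow> ('e \<Rightarrow> ennreal) \<Rightarrow> bool" where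
  "griffiths_semipositive D E h \<longleftrightarrow>
     (\<forall>U s. open U \<and> U \<subseteq> D \<and> holomorphic_dual_section E U s \<longrightarrow>
        plurisubharmonic_on U (\<lambda>x. enn_ln ((dual_len E h x (s x))\<^sup>2)))"

end

theory Submission
  imports Defs "HOL-Complex_Analysis.Conformal_Mappings"
begin

text \<open>Let \<open>u\<close> be a local holomorphic section of the dual bundle, let \<open>a\<close> be a unit vector at \<open>z\<close>, and let
  \<open>f\<^sub>m\<close> be the given extension of the \<open>m\<close>-th tensor power of \<open>a\<close>. The pairing of the \<open>m\<close>-th power of \<open>u\<close>
  with \<open>f\<^sub>m\<close> is a holomorphic function \<open>F\<^sub>m\<close> with \<open>F\<^sub>m(z) = u(a)\<^sup>m\<close> and \<open>|F\<^sub>m| \<le> |u|\<^sup>m |f\<^sub>m|\<close>, so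
  \<open>log |u(a)|\<close> is at most the mean of \<open>log |u| + (1/m) log |f\<^sub>m|\<close> over the boundary of any disc centred
  at \<open>z\<close>. Averaging over the directions \<open>w + \<eta>\<close> near \<open>w\<close> yields a disc on which the \<open>p\<close>-th powers of
  \<open>|F\<^sub>m| / |u|\<^sup>m\<close> have integral at most a constant times \<open>C\<^sub>m\<close>, so that the last term disappears as
  \<open>m\<close> tends to infinity. Finally \<open>\<eta>\<close> tends to 0: upper semicontinuity and Fatou's lemma
  give the mean value inequality in the direction \<open>w\<close> itself.\<close>

section \<open>Riesz representation and contraction of tensors\<close>

text \<open>The parallelogram law makes minimising sequences of \<open>J\<close> Cauchy, so
  completeness yields a minimiser; the vanishing first variation there is the
  representation.\<close>

lemma riesz_real:
  fixes f :: "'h::{real_inner, complete_space} \<Rightarrow> real"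
  assumes "bounded_linear f"
  shows "\<exists>w. \<forall>v. f v = inner v w"
proof -
  interpret f: bounded_linear f by fact
  obtain K where K: "\<And>x. \<bar>f x\<bar> \<le> norm x * K" using f.bounded by auto
  \<comment> \<open>If \<open>w\<close> represents \<open>f\<close>, then \<open>J v\<close> is the
    squared distance from \<open>v\<close> to \<open>w\<close> minus the squared norm of
    \<open>w\<close>.\<close>
  define J where "J v = (norm v)\<^sup>2 - 2 * f v" for v
  have "- (K\<^sup>2) \<le> J v" for v
  proof -
    have "0 \<le> (norm v - K)\<^sup>2" by simp
    then show ?thesis using K[of v] by (simp add: J_def power2_diff)
  qed
  then have bdd: "bdd_below (range J)" by (intro bdd_belowI) auto
  define m where "m = Inf (range J)"
  have mJ: "m \<le> J v" for v unfolding m_def by (rule cInf_lower[OF _ bdd]) simp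
  \<comment> \<open>Parallelogram law: the terms in \<open>f\<close> cancel, and \<open>m\<close>
    bounds \<open>J\<close> at the midpoint from below.\<close>
  have para: "(norm (x - y))\<^sup>2 \<le> 2 * (J x - m) + 2 * (J y - m)" for x y
  proof -
    have "(norm (x - y))\<^sup>2 = 2 * J x + 2 * J y - 4 * J ((1/2) *\<^sub>R (x + y))"
      by (simp add: J_def power2_norm_eq_inner inner_add_left inner_add_right inner_diff_left
          inner_diff_right f.add f.scaleR inner_commute[of y x] algebra_simps)
    then show ?thesis using mJ[of "(1/2) *\<^sub>R (x + y)"] by simp
  qed
  have "\<exists>x. J x < m + 1 / real (Suc n)" for n
    using cInf_lessD[of "range J" "m + 1 / real (Suc n)"] unfolding m_def[symmetric] by auto
  then obtain x where x: "\<And>n. J (x n) < m + 1 / real (Suc n)" by metis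
  have "Cauchy x"
  proof (rule metric_CauchyI)
    fix e :: real assume "e > 0"
    obtain N where N: "4 / e\<^sup>2 < real N" using reals_Archimedean2 by blast
    have "dist (x i) (x j) < e" if "i \<ge> N" "j \<ge> N" for i j
    proof -
      have "1 / real (Suc n) \<le> 1 / real (Suc N)" if "n \<ge> N" for n
        using that by (intro divide_left_mono) auto
      then have "(norm (x i - x j))\<^sup>2 < 4 * (1 / real (Suc N))"
        using para[of "x i" "x j"] x[of i] x[of j] that by (smt (verit))
      also have "\<dots> < e\<^sup>2" using N \<open>e > 0\<close> by (simp add: field_simps) (smt (verit) zero_less_power)
      finally show ?thesis using \<open>e > 0\<close> by (simp add: dist_norm power_less_imp_less_base)
    qed
    then show "\<exists>N. \<forall>i\<ge>N. \<forall>j\<ge>N. dist (x i) (x j) < e" by blast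
  qed
  then obtain w where w: "x \<longlonglongrightarrow> w" using Cauchy_convergent convergent_def by blast
  have "(\<lambda>n. J (x n)) \<longlonglongrightarrow> J w"
    unfolding J_def by (intro tendsto_intros w f.tendsto)
  moreover have "(\<lambda>n. m + 1 / real (Suc n)) \<longlonglongrightarrow> m + 0"
    using LIMSEQ_inverse_real_of_nat by (intro tendsto_intros) (simp add: inverse_eq_divide)
  ultimately have "J w \<le> m + 0"
    by (rule LIMSEQ_le) (use x less_imp_le in blast)
  then have Jw: "J w \<le> J v" for v using mJ[of v] by simp
  have "f v = inner v w" for v
  proof (cases "v = 0")
    case False
    define d where "d = inner v w - f v"
    \<comment> \<open>This choice minimises the quadratic polynomial
      \<open>J (w + s *\<^sub>R v)\<close> in \<open>s\<close>; its minimum lies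
      \<open>d\<^sup>2 / (norm v)\<^sup>2\<close> below \<open>J w\<close>.\<close>
    define s where "s = - d / (norm v)\<^sup>2"
    have "J (w + s *\<^sub>R v) - J w = 2 * s * d + s\<^sup>2 * (norm v)\<^sup>2"
      by (simp add: J_def d_def power2_norm_eq_inner inner_add_left inner_add_right f.add f.scaleR
          inner_commute[of w v] algebra_simps power2_eq_square[of s])
    also have "\<dots> = - (d\<^sup>2 / (norm v)\<^sup>2)"
      using False by (simp add: s_def power2_eq_square field_simps)
    finally have "d\<^sup>2 / (norm v)\<^sup>2 \<le> 0" using Jw[of "w + s *\<^sub>R v"] by simp
    then have "d = 0" using False by (simp add: divide_le_0_iff)
    then show ?thesis by (simp add: d_def)
  qed (simp add: f.zero)
  then show ?thesis by blast
qed

lemma cinner_scaleC_right: "cinner x (c *\<^sub>C y) = cnj c * cinner x y"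
  using cinner_commute[of x "c *\<^sub>C y"] cinner_commute[of x y] by (simp add: cinner_scaleC_left)

lemma cinner_add_right: "cinner x (y + z) = cinner x y + cinner x z"
  using cinner_commute[of x "y + z"] cinner_commute[of x y] cinner_commute[of x z]
  by (simp add: cinner_add_left)

lemma cinner_eqI:
  fixes x y :: "'h::complex_hilbert"
  assumes "\<And>v. cinner v x = cinner v y"
  shows "x = y"
proof -
  have "inner (x - y) x = inner (x - y) y" using assms[of "x - y"] Re_cinner by metis
  then have "inner (x - y) (x - y) = 0" by (simp add: inner_diff_right)
  then show ?thesis by simp
qed

lemma scaleC_minus_one: "(- 1) *\<^sub>C (x :: 'h::complex_normed) = - x"
  using scaleC_of_real[of "-1" x] by simp

text \<open>The right-hand side is the complex-linear part of \<open>l\<close>, and \<open>f\<close>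
  in the proof is its real part. The real Riesz theorem represents \<open>f\<close>; evaluating at
  \<open>\<i> *\<^sub>C v\<close> recovers the imaginary part.\<close>

lemma ex_riesz_vector:
  fixes l :: "'h::complex_hilbert \<Rightarrow>\<^sub>L complex"
  shows "\<exists>w. \<forall>v. cinner v w = (l v - \<i> * l (\<i> *\<^sub>C v)) / 2"
proof -
  define f where "f v = (Re (l v) + Im (l (\<i> *\<^sub>C v))) / 2" for v
  have "bounded_linear (\<lambda>v. (1/2) *\<^sub>R (Re (l v) + Im (l (\<i> *\<^sub>C v))))"
    by (intro bounded_linear_const_scaleR bounded_linear_add bounded_linear_compose[OF bounded_linear_Re]
        bounded_linear_compose[OF bounded_linear_Im] blinfun.bounded_linear_right
        bounded_linear_compose[OF blinfun.bounded_linear_right bounded_linear_scaleC])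
  then have "bounded_linear f" by (simp add: f_def[abs_def])
  then obtain w where w: "\<And>v. f v = inner v w" using riesz_real by blast
  have Re: "Re (cinner v w) = f v" for v by (simp add: w Re_cinner)
  have Im: "Im (cinner v w) = - f (\<i> *\<^sub>C v)" for v
    using Re[of "\<i> *\<^sub>C v"] by (simp add: cinner_scaleC_left)
  have "cinner v w = (l v - \<i> * l (\<i> *\<^sub>C v)) / 2" for v
    by (simp add: complex_eq_iff Re Im f_def scaleC_scaleC scaleC_minus_one blinfun.minus_right diff_divide_distrib)
  then show ?thesis by blast
qed

text \<open>On functionals that are only real-linear, the complex-linear part is represented; this makes
  the map conjugate-linear on the whole space of operators.\<close>

definition riesz_vector :: "('h::complex_hilbert \<Rightarrow>\<^sub>L complex) \<Rightarrow> 'h" where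
  "riesz_vector l = (SOME w. \<forall>v. cinner v w = (l v - \<i> * l (\<i> *\<^sub>C v)) / 2)"

lemma cinner_riesz_vector: "cinner v (riesz_vector l) = (l v - \<i> * l (\<i> *\<^sub>C v)) / 2"
  unfolding riesz_vector_def using someI_ex[OF ex_riesz_vector[of l]] by blast

lemma cinner_riesz_vector_complex_linear:
  "complex_linear l \<Longrightarrow> cinner v (riesz_vector l) = blinfun_apply l v"
  by (simp add: cinner_riesz_vector complex_linear_def scaleC_complex_def flip: mult.assoc)

lemma riesz_vector_add: "riesz_vector (l + l') = riesz_vector l + riesz_vector l'"
  by (rule cinner_eqI)
    (simp add: cinner_riesz_vector cinner_add_right blinfun.add_left algebra_simps add_divide_distrib diff_divide_distrib)

lemma riesz_vector_scaleC: "riesz_vector (c *\<^sub>C l) = cnj c *\<^sub>C riesz_vector l"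
  by (rule cinner_eqI)
    (simp add: cinner_riesz_vector cinner_scaleC_right scaleC_blinfun_apply scaleC_complex_def algebra_simps)

text \<open>Allows \<open>riesz_vector (l x)\<close> to be differentiated in \<open>x\<close>. The
  norm bound comes from pairing the representing vector with itself.\<close>

lemma bounded_linear_riesz_vector: "bounded_linear (riesz_vector :: ('h::complex_hilbert \<Rightarrow>\<^sub>L complex) \<Rightarrow> 'h)"
proof
  show "riesz_vector (l + l') = riesz_vector l + riesz_vector l'" for l l' :: "'h \<Rightarrow>\<^sub>L complex"
    by (rule riesz_vector_add)
  show "riesz_vector (r *\<^sub>R l) = r *\<^sub>R riesz_vector l" for r and l :: "'h \<Rightarrow>\<^sub>L complex"
    using riesz_vector_scaleC[of "complex_of_real r" l] by (simp add: scaleC_of_real)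
  have "norm (riesz_vector l) \<le> norm l" for l :: "'h \<Rightarrow>\<^sub>L complex"
  proof -
    define w where "w = riesz_vector l"
    have "norm (\<i> *\<^sub>C w) = norm w" by (simp add: norm_scaleC)
    then have "cmod (l w - \<i> * l (\<i> *\<^sub>C w)) \<le> 2 * (norm l * norm w)"
      using norm_blinfun[of l w] norm_blinfun[of l "\<i> *\<^sub>C w"] norm_triangle_ineq4[of "l w" "\<i> * l (\<i> *\<^sub>C w)"]
      by (simp add: norm_mult)
    moreover have "(norm w)\<^sup>2 = Re ((l w - \<i> * l (\<i> *\<^sub>C w)) / 2)"
      unfolding cinner_riesz_vector[symmetric] by (simp add: w_def Re_cinner power2_norm_eq_inner)
    ultimately have "norm w * norm w \<le> norm l * norm w"
      using complex_Re_le_cmod[of "l w - \<i> * l (\<i> *\<^sub>C w)"] by (simp add: power2_eq_square)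
    then show ?thesis unfolding w_def[symmetric]
      by (cases "w = 0") (auto simp: w_def)
  qed
  then show "\<exists>K. \<forall>l :: 'h \<Rightarrow>\<^sub>L complex. norm (riesz_vector l) \<le> norm l * K"
    by (intro exI[of _ 1]) simp
qed

section \<open>Contraction of Hilbert tensors with vectors\<close>

text \<open>One Gram-Schmidt step applied to \<open>w\<close>. The given family is retained so that
  sums over words in \<open>A\<close> can be compared with sums over words in
  \<open>A'\<close>.\<close>

lemma orthonormal_extension:
  fixes w :: "'h::complex_hilbert"
  assumes "finite A" "c_orthonormal A"
  shows "\<exists>A'. A \<subseteq> A' \<and> finite A' \<and> c_orthonormal A' \<and> w = (\<Sum>a\<in>A'. cinner w a *\<^sub>C a)"
proof -
  define r where "r = w - (\<Sum>a\<in>A. cinner w a *\<^sub>C a)"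
  have orth: "cinner r b = 0" if "b \<in> A" for b
  proof -
    have "(\<Sum>a\<in>A. cinner w a * cinner a b) = (\<Sum>a\<in>A. if a = b then cinner w b else 0)"
      using assms(2) that by (intro sum.cong) (auto simp: c_orthonormal_def)
    then show ?thesis
      using that assms(1) by (simp add: r_def cinner_minus_left cinner_sum_left cinner_scaleC_left)
  qed
  show ?thesis
  proof (cases "r = 0")
    case True
    then show ?thesis using assms by (intro exI[of _ A]) (auto simp: r_def)
  next
    case False
    define e where "e = complex_of_real (inverse (norm r)) *\<^sub>C r"
    have r: "r = complex_of_real (norm r) *\<^sub>C e"
      using False by (simp add: e_def scaleC_scaleC scaleC_one_hilbert)
    have "cinner r r = complex_of_real ((norm r)\<^sup>2)"
      using cinner_commute[of r r] by (simp add: complex_eq_iff Re_cinner power2_norm_eq_inner)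
    then have re: "cinner r e = complex_of_real (norm r)"
      using False by (simp add: e_def cinner_scaleC_right power2_eq_square del: of_real_inverse flip: of_real_mult)
    then have ee: "cinner e e = 1"
      using False by (simp add: e_def cinner_scaleC_left del: of_real_inverse flip: of_real_mult)
    have ea: "cinner e a = 0" "cinner a e = 0" if "a \<in> A" for a
      using orth[OF that] cinner_commute[of a e] by (simp_all add: e_def cinner_scaleC_left)
    have "e \<notin> A" using ea ee by force
    have "cinner w e = cinner r e"
    proof -
      have "cinner (\<Sum>a\<in>A. cinner w a *\<^sub>C a) e = 0"
        by (simp add: cinner_sum_left cinner_scaleC_left ea)
      then show ?thesis by (simp add: r_def cinner_minus_left)
    qed
    then have "cinner w e *\<^sub>C e = r" by (simp only: re flip: r)
    then have "w = (\<Sum>a\<in>insert e A. cinner w a *\<^sub>C a)"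
      using assms(1) \<open>e \<notin> A\<close> by (simp add: r_def)
    moreover have "c_orthonormal (insert e A)"
      using assms(2) ea ee \<open>e \<notin> A\<close> by (auto simp: c_orthonormal_def)
    ultimately show ?thesis using assms(1) by (intro exI[of _ "insert e A"]) auto
  qed
qed

lemma norm_sq_expansion:
  fixes w :: "'h::complex_hilbert"
  assumes "w = (\<Sum>a\<in>A. cinner w a *\<^sub>C a)"
  shows "(norm w)\<^sup>2 = (\<Sum>a\<in>A. (cmod (cinner w a))\<^sup>2)"
proof -
  have "cinner w w = (\<Sum>a\<in>A. cinner w a * cinner a w)"
    by (subst assms) (simp add: cinner_sum_left cinner_scaleC_left)
  also have "\<dots> = (\<Sum>a\<in>A. complex_of_real ((cmod (cinner w a))\<^sup>2))"
    by (intro sum.cong refl) (metis cinner_commute complex_norm_square)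
  finally have "Re (cinner w w) = (\<Sum>a\<in>A. (cmod (cinner w a))\<^sup>2)" by simp
  then show ?thesis by (simp add: Re_cinner power2_norm_eq_inner)
qed

text \<open>Expand \<open>w\<close> in an orthonormal family \<open>A'\<close> containing
  \<open>A\<close> and apply Cauchy-Schwarz in the first slot; the words \<open>a # ws\<close> that
  arise all occur in one partial sum of \<open>T\<close>.\<close>

lemma hs_partial_cons_le:
  fixes T :: "'h::complex_hilbert list \<Rightarrow> complex"
  assumes T: "conj_multilinear T" and bound: "\<And>X. X \<in> finite_orthonormal \<Longrightarrow> hs_partial T X \<le> B"
    and X: "X \<in> finite_orthonormal"
  shows "hs_partial (\<lambda>ws. T (w # ws)) X \<le> norm w * B"
proof -
  obtain A N where X_eq: "X = (A, N)" by (cases X)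
  then have A: "finite A" "c_orthonormal A" using X by (auto simp: finite_orthonormal_def)
  obtain A' where A': "A \<subseteq> A'" "finite A'" "c_orthonormal A'"
    and w: "w = (\<Sum>a\<in>A'. cinner w a *\<^sub>C a)"
    using orthonormal_extension[OF A] by blast
  \<comment> \<open>Prepending a letter lengthens words by one, hence \<open>Suc N\<close>.\<close>
  have X': "(A', Suc N) \<in> finite_orthonormal" using A' by (simp add: finite_orthonormal_def)
  have "B \<ge> 0" using bound[OF X'] hs_partial_nonneg order_trans by blast
  have pw: "(cmod (T (w # ws)))\<^sup>2 \<le> (norm w)\<^sup>2 * (\<Sum>a\<in>A'. (cmod (T (a # ws)))\<^sup>2)" for ws
  proof -
    have "T (w # ws) = (\<Sum>a\<in>A'. cnj (cinner w a) * T (a # ws))"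
      using conj_multilinear_sum[OF T A'(2), of "[]" "cinner w" ws, folded w] by simp
    then have "cmod (T (w # ws)) \<le> (\<Sum>a\<in>A'. cmod (cinner w a) * cmod (T (a # ws)))"
      using norm_sum[of "\<lambda>a. cnj (cinner w a) * T (a # ws)" A'] by (simp add: norm_mult)
    then have "(cmod (T (w # ws)))\<^sup>2 \<le> (\<Sum>a\<in>A'. cmod (cinner w a) * cmod (T (a # ws)))\<^sup>2"
      by (intro power_mono) auto
    also have "\<dots> \<le> (\<Sum>a\<in>A'. (cmod (cinner w a))\<^sup>2) * (\<Sum>a\<in>A'. (cmod (T (a # ws)))\<^sup>2)"
      by (rule Cauchy_Schwarz_ineq_sum)
    finally show ?thesis by (simp only: norm_sq_expansion[OF w])
  qed
  have "(\<Sum>ws\<in>lists_upto A N. (cmod (T (w # ws)))\<^sup>2)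
      \<le> (\<Sum>ws\<in>lists_upto A N. (norm w)\<^sup>2 * (\<Sum>a\<in>A'. (cmod (T (a # ws)))\<^sup>2))"
    by (intro sum_mono pw)
  also have "\<dots> = (norm w)\<^sup>2 * (\<Sum>(ws, a)\<in>lists_upto A N \<times> A'. (cmod (T (a # ws)))\<^sup>2)"
    by (simp only: sum.cartesian_product flip: sum_distrib_left)
  finally have sum_le: "(\<Sum>ws\<in>lists_upto A N. (cmod (T (w # ws)))\<^sup>2)
      \<le> (norm w)\<^sup>2 * (\<Sum>(ws, a)\<in>lists_upto A N \<times> A'. (cmod (T (a # ws)))\<^sup>2)" .
  \<comment> \<open>The word \<open>a # ws\<close> determines \<open>a\<close> and
    \<open>ws\<close>, so the double sum runs over a subset of
    \<open>lists_upto A' (Suc N)\<close>.\<close>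
  have "(\<Sum>(ws, a)\<in>lists_upto A N \<times> A'. (cmod (T (a # ws)))\<^sup>2)
      = (\<Sum>us\<in>(\<lambda>(ws, a). a # ws) ` (lists_upto A N \<times> A'). (cmod (T us))\<^sup>2)"
    by (subst sum.reindex) (auto simp: inj_on_def intro!: sum.cong)
  also have "\<dots> \<le> (\<Sum>us\<in>lists_upto A' (Suc N). (cmod (T us))\<^sup>2)"
    using A' by (intro sum_mono2 finite_lists_upto) (auto simp: lists_upto_def)
  also have "\<dots> = (hs_partial T (A', Suc N))\<^sup>2"
    by (simp add: hs_partial_def L2_set_def sum_nonneg)
  also have "\<dots> \<le> B\<^sup>2" by (intro power_mono bound X' hs_partial_nonneg)
  finally have "(norm w)\<^sup>2 * (\<Sum>(ws, a)\<in>lists_upto A N \<times> A'. (cmod (T (a # ws)))\<^sup>2) \<le> (norm w)\<^sup>2 * B\<^sup>2"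
    by (rule mult_left_mono) simp
  with sum_le have "(\<Sum>ws\<in>lists_upto A N. (cmod (T (w # ws)))\<^sup>2) \<le> (norm w * B)\<^sup>2"
    unfolding power_mult_distrib by (rule order_trans)
  moreover have "(hs_partial (\<lambda>ws. T (w # ws)) X)\<^sup>2 = (\<Sum>ws\<in>lists_upto A N. (cmod (T (w # ws)))\<^sup>2)"
    by (simp add: X_eq hs_partial_def L2_set_def sum_nonneg)
  ultimately have "(hs_partial (\<lambda>ws. T (w # ws)) X)\<^sup>2 \<le> (norm w * B)\<^sup>2" by simp
  then show ?thesis by (rule power2_le_imp_le) (simp add: \<open>B \<ge> 0\<close>)
qed

text \<open>The annihilation operator on the full Fock space: the adjoint of tensoring with
  \<open>w\<close> from the left, hence conjugate-linear in \<open>w\<close>.\<close>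

lift_definition contract :: "'h::complex_hilbert \<Rightarrow> 'h tensor \<Rightarrow> 'h tensor"
  is "\<lambda>w T ws. T (w # ws)"
proof -
  fix w :: 'h and T :: "'h list \<Rightarrow> complex"
  assume T: "conj_multilinear T \<and> bdd_above (hs_partial T ` finite_orthonormal)"
  then obtain B where B: "\<And>X. X \<in> finite_orthonormal \<Longrightarrow> hs_partial T X \<le> B"
    unfolding bdd_above_def by blast
  have "bdd_above (hs_partial (\<lambda>ws. T (w # ws)) ` finite_orthonormal)"
    using T B by (intro bdd_aboveI2[of _ _ "norm w * B"] hs_partial_cons_le) auto
  moreover have "conj_multilinear (\<lambda>ws. T (w # ws))"
    using T unfolding conj_multilinear_def by (metis append_Cons)
  ultimately show "conj_multilinear (\<lambda>ws. T (w # ws)) \<and>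
      bdd_above (hs_partial (\<lambda>ws. T (w # ws)) ` finite_orthonormal)" by blast
qed

lemma conj_multilinear_tensor_apply: "conj_multilinear (tensor_apply T)"
  using tensor_apply[of T] by simp

lemma tensor_apply_scaleR: "tensor_apply (r *\<^sub>R T) ws = complex_of_real r * tensor_apply T ws"
  by (simp add: scaleR_tensor_def scaleC_tensor.rep_eq)

lemma tensor_eqI: "(\<And>ws. tensor_apply S ws = tensor_apply T ws) \<Longrightarrow> S = T"
  by (simp add: tensor_apply_inject[symmetric] fun_eq_iff)

lemma contract_scaleC_left: "contract (c *\<^sub>C w) T = cnj c *\<^sub>C contract w T"
  using conj_multilinear_tensor_apply[of T] unfolding conj_multilinear_def
  by (intro tensor_eqI) (metis append_Nil contract.rep_eq scaleC_tensor.rep_eq)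

lemma contract_scaleC_right: "contract w (c *\<^sub>C T) = c *\<^sub>C contract w T"
  by (intro tensor_eqI) (simp add: contract.rep_eq scaleC_tensor.rep_eq)

text \<open>Supplies the product rule for contractions. Bilinearity is meant over the reals; the
  bound on partial sums gives the norm estimate with constant 1.\<close>

lemma bounded_bilinear_contract: "bounded_bilinear (contract :: 'h::complex_hilbert \<Rightarrow> _)"
proof
  fix a b :: 'h and S T :: "'h tensor" and r :: real
  show "contract (a + b) T = contract a T + contract b T"
    using conj_multilinear_tensor_apply[of T] unfolding conj_multilinear_def
    by (intro tensor_eqI) (metis append_Nil contract.rep_eq plus_tensor.rep_eq)
  show "contract a (S + T) = contract a S + contract a T"
    by (intro tensor_eqI) (simp add: contract.rep_eq plus_tensor.rep_eq)
  show "contract (r *\<^sub>R a) T = r *\<^sub>R contract a T"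
    using contract_scaleC_left[of "complex_of_real r" a T] by (simp add: scaleC_of_real)
  show "contract a (r *\<^sub>R T) = r *\<^sub>R contract a T"
    by (simp add: scaleR_tensor_def contract_scaleC_right)
  have "norm (contract a T) \<le> norm a * norm T" for a :: 'h and T
    unfolding contract.rep_eq
    by (rule norm_tensor_le, unfold contract.rep_eq)
      (intro hs_partial_cons_le conj_multilinear_tensor_apply hs_partial_le_norm)
  then show "\<exists>K. \<forall>a T. norm (contract a T :: 'h tensor) \<le> norm a * norm T * K"
    by (intro exI[of _ 1]) simp
qed

text \<open>Evaluation at \<open>m\<close> equal vectors becomes an iterate of one bilinear map, so
  that its holomorphy follows by induction on \<open>m\<close>.\<close>

lemma tensor_apply_contract_power:
  "tensor_apply ((contract w ^^ m) T) ws = tensor_apply T (replicate m w @ ws)"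
  by (induction m arbitrary: ws) (simp_all add: contract.rep_eq replicate_app_Cons_same)

lemma bounded_linear_tensor_apply_Nil: "bounded_linear (\<lambda>T :: 'h::complex_hilbert tensor. tensor_apply T [])"
proof
  show "tensor_apply (S + T) [] = tensor_apply S [] + tensor_apply T []" for S T :: "'h tensor"
    by (simp add: plus_tensor.rep_eq)
  show "tensor_apply (r *\<^sub>R T) [] = r *\<^sub>R tensor_apply T []" for r and T :: "'h tensor"
    by (simp add: tensor_apply_scaleR scaleR_conv_of_real)
  have "cmod (tensor_apply T []) \<le> norm T" for T :: "'h tensor"
    using hs_partial_le_norm[of "({}, 0)" T]
    by (auto simp: hs_partial_def lists_upto_def finite_orthonormal_def c_orthonormal_def cong: conj_cong)
  then show "\<exists>K. \<forall>T :: 'h tensor. cmod (tensor_apply T []) \<le> norm T * K"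
    by (intro exI[of _ 1]) simp
qed

text \<open>Both \<open>riesz_vector\<close> and the first slot of \<open>contract\<close> are
  conjugate-linear. The two conjugations cancel, which makes the derivative from the product rule
  complex-linear.\<close>

lemma holomorphic_map_on_contract_riesz:
  fixes F :: "complex^'n \<Rightarrow> 'h::complex_hilbert tensor" and l :: "complex^'n \<Rightarrow> 'h \<Rightarrow>\<^sub>L complex"
  assumes "holomorphic_map_on V F" "holomorphic_map_on V l"
  shows "holomorphic_map_on V (\<lambda>x. contract (riesz_vector (l x)) (F x))"
  unfolding holomorphic_map_on_def
proof
  fix x assume "x \<in> V"
  then obtain DF Dl where F: "(F has_derivative DF) (at x)" "\<And>c v. DF (c *s v) = c *\<^sub>C DF v"
    and l: "(l has_derivative Dl) (at x)" "\<And>c v. Dl (c *s v) = c *\<^sub>C Dl v"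
    using assms unfolding holomorphic_map_on_def by meson
  have "((\<lambda>x. riesz_vector (l x)) has_derivative (\<lambda>v. riesz_vector (Dl v))) (at x)"
    by (rule bounded_linear.has_derivative[OF bounded_linear_riesz_vector l(1)])
  note D = bounded_bilinear.FDERIV[OF bounded_bilinear_contract this F(1)]
  show "\<exists>L. ((\<lambda>x. contract (riesz_vector (l x)) (F x)) has_derivative L) (at x) \<and>
      (\<forall>c v. L (c *s v) = c *\<^sub>C L v)"
    by (rule exI, rule conjI, rule D) (simp add: F(2) l(2) riesz_vector_scaleC contract_scaleC_left
        contract_scaleC_right scaleC_add_right)
qed

lemma holomorphic_map_on_tensor_apply_riesz:
  fixes F :: "complex^'n \<Rightarrow> 'h::complex_hilbert tensor" and l :: "complex^'n \<Rightarrow> 'h \<Rightarrow>\<^sub>L complex"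
  assumes "holomorphic_map_on V F" "holomorphic_map_on V l"
  shows "holomorphic_map_on V (\<lambda>x. tensor_apply (F x) (replicate m (riesz_vector (l x))))"
proof -
  have "holomorphic_map_on V (\<lambda>x. (contract (riesz_vector (l x)) ^^ m) (F x))"
    by (induction m) (simp_all add: assms holomorphic_map_on_contract_riesz)
  then show ?thesis
    unfolding holomorphic_map_on_def
  proof (intro ballI, elim ballE exE conjE)
    fix x L assume L: "((\<lambda>x. (contract (riesz_vector (l x)) ^^ m) (F x)) has_derivative L) (at x)"
      "\<forall>c v. L (c *s v) = c *\<^sub>C L v"
    show "\<exists>L. ((\<lambda>x. tensor_apply (F x) (replicate m (riesz_vector (l x)))) has_derivative L) (at x) \<and>
        (\<forall>c v. L (c *s v) = c *\<^sub>C L v)"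
      using bounded_linear.has_derivative[OF bounded_linear_tensor_apply_Nil L(1)] L(2)
      by (intro exI[of _ "\<lambda>v. tensor_apply (L v) []"])
        (simp add: tensor_apply_contract_power scaleC_tensor.rep_eq scaleC_complex_def)
  qed auto
qed

lemma holomorphic_map_on_imp_continuous_on:
  "holomorphic_map_on U f \<Longrightarrow> continuous_on U f"
  unfolding holomorphic_map_on_def
  by (meson continuous_at_imp_continuous_on has_derivative_continuous)


section \<open>Logarithmic means over circles\<close>

text \<open>The maximum principle for the product of \<open>F(\<omega> \<zeta>)\<close> over the \<open>N\<close>-th roots of unity \<open>\<omega>\<close> bounds
  \<open>ln |F 0|\<close> by a Riemann sum; no zeros of \<open>F\<close> have to be factored out.\<close>

lemma ln_norm_le_circle_integral:
  fixes F :: "complex \<Rightarrow> complex"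
  assumes holo: "F holomorphic_on S" and "open S" and S: "cball 0 1 \<subseteq> S"
    and "\<delta> > 0" and "F 0 \<noteq> 0"
  shows "2 * pi * ln (cmod (F 0)) \<le> integral {0..2*pi} (\<lambda>\<theta>. ln (max (cmod (F (cis \<theta>))) \<delta>))"
proof -
  \<comment> \<open>The cut-off at \<open>\<delta>\<close> keeps \<open>u\<close> continuous where
    \<open>F\<close> vanishes on the circle.\<close>
  define u where "u = (\<lambda>\<theta>. ln (max (cmod (F (cis \<theta>))) \<delta>))"
  define I where "I = integral {0..2*pi} u"
  have contF: "continuous_on (cball 0 1) F"
    using holo S holomorphic_on_imp_continuous_on continuous_on_subset by blast
  have "continuous_on UNIV (\<lambda>\<theta>. F (cis \<theta>))"
    by (rule continuous_on_compose2[OF contF]) (auto intro!: continuous_intros)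
  then have u_cont: "continuous_on A u" for A
    unfolding u_def using \<open>\<delta> > 0\<close>
    by (intro continuous_on_ln continuous_on_max continuous_on_norm continuous_on_const)
      (auto intro: continuous_on_subset simp: max_def split: if_splits)
  have u_int: "u integrable_on {a..b}" for a b
    by (intro integrable_continuous_interval u_cont)
  have u_per: "u (\<theta> + 2 * pi) = u \<theta>" for \<theta>
    by (simp add: u_def cis.code)
  \<comment> \<open>By periodicity the Riemann sum may start at any angle.\<close>
  have I_shift: "integral {\<theta>..\<theta> + 2*pi} u = I" if "\<theta> \<in> {0..2*pi}" for \<theta>
  proof -
    have "integral {0..\<theta>} u + integral {\<theta>..\<theta> + 2*pi} u = integral {0..\<theta> + 2*pi} u"
      using that by (intro Henstock_Kurzweil_Integration.integral_combine u_int) auto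
    moreover have "I + integral {2*pi..\<theta> + 2*pi} u = integral {0..\<theta> + 2*pi} u"
      unfolding I_def using that by (intro Henstock_Kurzweil_Integration.integral_combine u_int) auto
    moreover have "integral {0..\<theta>} (u \<circ> (\<lambda>x. x + 2*pi)) = integral {0 + 2*pi..\<theta> + 2*pi} u"
      by (rule integral_shift[OF u_cont])
    ultimately show ?thesis by (simp add: o_def u_per)
  qed
  have "2 * pi * ln (cmod (F 0)) \<le> I + \<epsilon>" if "\<epsilon> > 0" for \<epsilon>
  proof -
    \<comment> \<open>An error of \<open>e\<close> per unit of length accumulates to
      \<open>\<epsilon>\<close> over a full period.\<close>
    define e where "e = \<epsilon> / (2 * pi)"
    have "e > 0" using that by (simp add: e_def)
    \<comment> \<open>The interval accommodates a full period after any starting angle in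
      \<open>{0..2*pi}\<close>.\<close>
    have "uniformly_continuous_on {0..4*pi} u"
      by (intro compact_uniformly_continuous u_cont) auto
    then obtain d where "d > 0" and
      d: "\<And>x y. x \<in> {0..4*pi} \<Longrightarrow> y \<in> {0..4*pi} \<Longrightarrow> dist x y < d \<Longrightarrow> dist (u x) (u y) < e"
      using \<open>e > 0\<close> unfolding uniformly_continuous_on_def by metis
    obtain N :: nat where N: "2 * pi / d < real N" using reals_Archimedean2 by blast
    have "0 < 2 * pi / d" using \<open>d > 0\<close> by simp
    then have "N > 0" using N by (intro Nat.gr0I) auto
    define t where "t = 2 * pi / real N"
    have "t > 0" and tN: "t * real N = 2 * pi" using \<open>N > 0\<close> by (auto simp: t_def)
    have "t < d" using N \<open>d > 0\<close> \<open>N > 0\<close> by (simp add: t_def field_simps)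
    have riemann: "(\<Sum>k<n. t * (u (\<theta> + t * real k) - e)) \<le> integral {\<theta>..\<theta> + t * real n} u"
      if \<theta>: "\<theta> \<in> {0..2*pi}" and "n \<le> N" for n \<theta>
      using \<open>n \<le> N\<close>
    proof (induction n)
      case 0
      then show ?case by simp
    next
      case (Suc n)
      let ?a = "\<theta> + t * real n" and ?b = "\<theta> + t * real (Suc n)"
      have "t * real (Suc n) \<le> t * real N"
        using Suc.prems \<open>t > 0\<close> by (intro mult_left_mono) auto
      then have ab: "0 \<le> ?a" "?b \<le> 4 * pi" "?b = ?a + t" and "0 \<le> t * real n"
        using \<theta> \<open>t > 0\<close> tN by (auto simp: algebra_simps)
      have "t * (u ?a - e) = integral {?a..?b} (\<lambda>_. u ?a - e)"
        using ab \<open>t > 0\<close> by simp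
      also have "\<dots> \<le> integral {?a..?b} u"
      proof (rule integral_le)
        fix x assume x: "x \<in> {?a..?b}"
        then have "dist ?a x < d" "?a \<in> {0..4*pi}" "x \<in> {0..4*pi}"
          using ab \<open>t < d\<close> \<open>t > 0\<close> by (auto simp: dist_real_def)
        then have "dist (u ?a) (u x) < e" using d by blast
        then show "u ?a - e \<le> u x" by (auto simp: dist_real_def)
      qed (auto intro: u_int)
      finally have "t * (u ?a - e) \<le> integral {?a..?b} u" .
      moreover have "integral {\<theta>..?a} u + integral {?a..?b} u = integral {\<theta>..?b} u"
        using ab \<open>t > 0\<close> \<open>0 \<le> t * real n\<close> by (intro Henstock_Kurzweil_Integration.integral_combine u_int) auto
      ultimately show ?case using Suc by simp
    qed
    define P where "P = (\<lambda>\<zeta>. \<Prod>k<N. F (cis (t * real k) * \<zeta>))"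
    have holoP: "P holomorphic_on interior (cball 0 1)"
      unfolding P_def
    proof (rule holomorphic_on_prod)
      fix k
      have "(\<lambda>\<zeta>. cis (t * real k) * \<zeta>) ` interior (cball 0 1) \<subseteq> S"
        using S by (auto simp: norm_mult subset_iff)
      then show "(\<lambda>\<zeta>. F (cis (t * real k) * \<zeta>)) holomorphic_on interior (cball 0 1)"
        by (intro holomorphic_on_compose_gen[OF _ holo, unfolded o_def]) (auto intro!: holomorphic_intros)
    qed
    have contP: "continuous_on (closure (cball 0 1)) P"
      unfolding P_def
      by (intro continuous_on_prod continuous_on_compose2[OF contF])
        (auto intro!: continuous_intros simp: norm_mult)
    have "cmod (P 0) \<le> exp ((I + \<epsilon>) / t)"
    proof (rule maximum_modulus_frontier[OF holoP contP])
      fix \<zeta> :: complex assume "\<zeta> \<in> frontier (cball 0 1)"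
      then have "cmod \<zeta> = 1" by simp
      then obtain \<theta> where \<theta>: "\<theta> \<in> {0..2*pi}" "\<zeta> = cis \<theta>"
        by (metis Arg2pi_ge_0 Arg2pi_lt_2pi atLeastAtMost_iff cis_conv_exp complex_norm_eq_1_exp less_imp_le)
      have "cmod (P \<zeta>) = (\<Prod>k<N. cmod (F (cis (\<theta> + t * real k))))"
        by (simp add: P_def \<theta> cis_mult prod_norm add.commute)
      also have "\<dots> \<le> (\<Prod>k<N. exp (u (\<theta> + t * real k)))"
        using \<open>\<delta> > 0\<close> by (intro prod_mono) (auto simp: u_def)
      also have "\<dots> = exp (\<Sum>k<N. u (\<theta> + t * real k))" by (simp add: exp_sum)
      also have "(\<Sum>k<N. u (\<theta> + t * real k)) \<le> (I + \<epsilon>) / t"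
      proof -
        have "t * (\<Sum>k<N. u (\<theta> + t * real k)) - t * real N * e \<le> I"
          using riemann[OF \<theta>(1), of N] I_shift[OF \<theta>(1)]
          by (simp add: tN sum_subtractf flip: sum_distrib_left) (simp add: algebra_simps tN)
        then show ?thesis using \<open>t > 0\<close> by (simp add: tN e_def field_simps)
      qed
      finally show "cmod (P \<zeta>) \<le> exp ((I + \<epsilon>) / t)" by simp
    qed auto
    \<comment> \<open>At the centre the \<open>N\<close> factors coincide. Taking logarithms and
      multiplying by \<open>t\<close> turns \<open>N\<close> into the length of the period.\<close>
    then have "cmod (F 0) ^ N \<le> exp ((I + \<epsilon>) / t)" by (simp add: P_def prod_norm norm_power)
    then have "ln (cmod (F 0) ^ N) \<le> ln (exp ((I + \<epsilon>) / t))"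
      using \<open>F 0 \<noteq> 0\<close> by (subst ln_le_cancel_iff) auto
    then have "real N * ln (cmod (F 0)) \<le> (I + \<epsilon>) / t"
      using \<open>F 0 \<noteq> 0\<close> by (simp add: ln_realpow)
    then have "(t * real N) * ln (cmod (F 0)) \<le> I + \<epsilon>"
      using \<open>t > 0\<close> by (simp add: field_simps)
    then show ?thesis by (simp only: tN)
  qed
  then show ?thesis unfolding I_def u_def by (rule field_le_epsilon)
qed

section \<open>Invariance of Lebesgue measure under translations and rotations\<close>

lemma nn_integral_lborel_translate:
  fixes f :: "'a::euclidean_space \<Rightarrow> ennreal"
  assumes "f \<in> borel_measurable borel"
  shows "(\<integral>\<^sup>+x. f (x + c) \<partial>lborel) = (\<integral>\<^sup>+x. f x \<partial>lborel)"
proof -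
  have "(\<integral>\<^sup>+x. f x \<partial>distr lborel borel ((+) c)) = (\<integral>\<^sup>+x. f (c + x) \<partial>lborel)"
    by (rule nn_integral_distr) (use assms in auto)
  then show ?thesis by (simp add: lborel_distr_plus add.commute)
qed

text \<open>The argument for the uniqueness of Haar measure: a ball, which \<open>S\<close> preserves, serves as the
  reference set, and two translations are exchanged by Fubini's theorem.\<close>

lemma nn_integral_lborel_isometry:
  fixes f :: "'a::euclidean_space \<Rightarrow> ennreal" and S :: "'a \<Rightarrow> 'a"
  assumes f [measurable]: "f \<in> borel_measurable borel"
    and "linear S" and iso: "\<And>x. norm (S x) = norm x" and surj: "surj S"
  shows "(\<integral>\<^sup>+x. f (S x) \<partial>lborel) = (\<integral>\<^sup>+x. f x \<partial>lborel)"
proof -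
  interpret linear S by fact
  have [measurable]: "S \<in> borel_measurable borel"
    using \<open>linear S\<close> by (intro borel_measurable_continuous_onI linear_continuous_on)
      (simp add: linear_conv_bounded_linear)
  define B where "B = ball (0::'a) 1"
  have [measurable]: "B \<in> sets borel" by (simp add: B_def)
  define b where "b = (indicator B :: 'a \<Rightarrow> ennreal)"
  have [measurable]: "b \<in> borel_measurable borel" by (simp add: b_def)
  define \<beta> where "\<beta> = emeasure lborel B"
  have \<beta>: "(\<integral>\<^sup>+x. b x \<partial>lborel) = \<beta>" by (simp add: b_def \<beta>_def)
  have "\<beta> \<noteq> 0"
    using open_not_negligible[of B]
    by (auto simp: \<beta>_def B_def emeasure_lborel_ball_finite negligible_iff_emeasure0 emeasure_completion)
  have "\<beta> \<noteq> \<infinity>" using emeasure_lborel_ball_finite[of "0::'a" 1] by (simp add: \<beta>_def B_def)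
  have bS: "b (- S x) = b x" for x by (simp add: b_def B_def indicator_def iso)
  have "(\<integral>\<^sup>+x. f (S x) \<partial>lborel) * \<beta> = (\<integral>\<^sup>+x. f (S x) * (\<integral>\<^sup>+y. b (y + - S x) \<partial>lborel) \<partial>lborel)"
    by (simp add: nn_integral_lborel_translate nn_integral_multc \<beta> del: add_uminus_conv_diff)
  also have "\<dots> = (\<integral>\<^sup>+x. \<integral>\<^sup>+y. f (S x) * b (y + - S x) \<partial>lborel \<partial>lborel)"
    by (simp add: nn_integral_cmult)
  also have "\<dots> = (\<integral>\<^sup>+y. \<integral>\<^sup>+x. f (S x) * b (y + - S x) \<partial>lborel \<partial>lborel)"
    by (rule lborel_pair.Fubini'[symmetric]) measurable
  also have "\<dots> = (\<integral>\<^sup>+y. \<integral>\<^sup>+x. f (y + S x) * b x \<partial>lborel \<partial>lborel)"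
  proof (rule nn_integral_cong)
    fix y
    \<comment> \<open>Translating \<open>x\<close> by \<open>c\<close> turns \<open>y - S x\<close>
      into \<open>- S x\<close>, which \<open>b\<close> does not distinguish from
      \<open>x\<close>.\<close>
    obtain c where c: "y = S c" using surj by auto
    show "(\<integral>\<^sup>+x. f (S x) * b (y + - S x) \<partial>lborel) = (\<integral>\<^sup>+x. f (y + S x) * b x \<partial>lborel)"
      by (subst nn_integral_lborel_translate[of "\<lambda>x. f (S x) * b (y + - S x)" c, symmetric])
        (auto simp: c add algebra_simps bS)
  qed
  also have "\<dots> = (\<integral>\<^sup>+x. \<integral>\<^sup>+y. f (y + S x) * b x \<partial>lborel \<partial>lborel)"
    by (rule lborel_pair.Fubini') measurable
  also have "\<dots> = (\<integral>\<^sup>+x. f x \<partial>lborel) * \<beta>"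
    by (simp add: nn_integral_multc nn_integral_cmult nn_integral_lborel_translate \<beta>)
  finally show ?thesis
    using \<open>\<beta> \<noteq> 0\<close> \<open>\<beta> \<noteq> \<infinity>\<close> by (metis ennreal_mult_cancel_left mult.commute ennreal_mult_right_cong infinity_ennreal_def)
qed

lemma norm_vector_smult:
  fixes v :: "'a::real_normed_div_algebra ^ 'n"
  shows "norm (c *s v) = norm c * norm v"
  by (simp add: norm_vec_def L2_set_right_distrib norm_mult)

lemma bounded_bilinear_vector_smult:
  "bounded_bilinear ((*s) :: complex \<Rightarrow> complex^'n \<Rightarrow> complex^'n)"
  by (rule bounded_bilinear.intro)
    (auto simp: vec_eq_iff algebra_simps norm_vector_smult intro!: exI[of _ 1])

lemmas continuous_on_vector_smult = bounded_bilinear.continuous_on[OF bounded_bilinear_vector_smult]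

lemma continuous_cis_disc:
  "continuous_on A (\<lambda>(\<theta>, \<eta>). z + cis \<theta> *s (w + \<eta> :: complex^'n))"
  unfolding case_prod_unfold by (intro continuous_intros continuous_on_vector_smult)

text \<open>For a fixed angle, the boundary point of the disc depends on the perturbation of the
  direction by a rotation and a translation. Averaging over perturbations therefore costs no
  Jacobian factor.\<close>

lemma nn_integral_cis_smult:
  fixes f :: "complex^'n \<Rightarrow> ennreal"
  assumes [measurable]: "f \<in> borel_measurable borel"
  shows "(\<integral>\<^sup>+x. f (z + cis \<theta> *s (w + x)) \<partial>lborel) = (\<integral>\<^sup>+x. f x \<partial>lborel)"
proof -
  have lin: "linear ((*s) (cis \<theta>) :: complex^'n \<Rightarrow> complex^'n)"
    by (rule linearI) (auto simp: vec_eq_iff algebra_simps)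
  have "x = cis \<theta> *s (cis (- \<theta>) *s x)" for x :: "complex^'n"
    by (simp add: vec_eq_iff cis_mult mult.assoc[symmetric])
  then have surj: "surj ((*s) (cis \<theta>) :: complex^'n \<Rightarrow> complex^'n)" by (metis surjI)
  have "(\<integral>\<^sup>+x. f (cis \<theta> *s x + (z + cis \<theta> *s w)) \<partial>lborel) = (\<integral>\<^sup>+x. f (x + (z + cis \<theta> *s w)) \<partial>lborel)"
    by (rule nn_integral_lborel_isometry[OF _ lin _ surj]) (auto simp: norm_vector_smult)
  then show ?thesis
    by (simp add: nn_integral_lborel_translate vector_add_ldistrib add_ac)
qed

section \<open>Selection of a disc in a nearby direction\<close>

text \<open>By Tonelli, the circle integrals averaged over \<open>\<eta>\<close> in the ball are at
  most \<open>2 * pi * C\<close> divided by the volume of the ball. Some \<open>\<eta>\<close> must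
  stay below twice that average; the doubling makes the contradiction strict.\<close>

lemma ex_disc_nn_integral_le:
  fixes Q :: "complex^'n \<Rightarrow> ennreal"
  assumes [measurable]: "Q \<in> borel_measurable borel"
    and int: "(\<integral>\<^sup>+x. Q x \<partial>lborel) \<le> ennreal C" and "C > 0" and "r > 0"
  shows "\<exists>\<eta>\<in>ball 0 r. (\<integral>\<^sup>+\<theta>\<in>{0..2*pi}. Q (z + cis \<theta> *s (w + \<eta>)) \<partial>lborel)
    \<le> ennreal (4 * pi * C / measure lborel (ball 0 r :: (complex^'n) set))"
proof (rule ccontr)
  define B :: "(complex^'n) set" where "B = ball 0 r"
  define \<beta> where "\<beta> = measure lborel B"
  have "\<beta> > 0" using \<open>r > 0\<close> by (simp add: \<beta>_def B_def content_ball_pos)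
  have em: "emeasure lborel B = ennreal \<beta>"
    unfolding \<beta>_def B_def by (rule emeasure_eq_ennreal_measure)
      (use emeasure_lborel_ball_finite in \<open>auto simp: less_top[symmetric]\<close>)
  have [measurable]: "B \<in> sets borel" by (simp add: B_def)
  have [measurable]: "(\<lambda>(\<theta>, \<eta>). z + cis \<theta> *s (w + \<eta>)) \<in> borel \<Otimes>\<^sub>M borel \<rightarrow>\<^sub>M borel"
    unfolding borel_prod by (rule borel_measurable_continuous_onI[OF continuous_cis_disc])
  define g where "g \<theta> \<eta> = Q (z + cis \<theta> *s (w + \<eta>))" for \<theta> \<eta>
  have [measurable]: "case_prod g \<in> borel_measurable (borel \<Otimes>\<^sub>M borel)"
    unfolding g_def case_prod_unfold by measurable
  assume "\<not> ?thesis"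
  then have big: "ennreal (4 * pi * C / \<beta>) \<le> (\<integral>\<^sup>+\<theta>\<in>{0..2*pi}. g \<theta> \<eta> \<partial>lborel)" if "\<eta> \<in> B" for \<eta>
    using that unfolding B_def[symmetric] \<beta>_def[symmetric] g_def by (auto simp: not_le intro: less_imp_le)
  have "ennreal (4 * pi * C) = (\<integral>\<^sup>+\<eta>\<in>B. ennreal (4 * pi * C / \<beta>) \<partial>lborel)"
    using \<open>\<beta> > 0\<close> \<open>C > 0\<close> by (simp add: nn_integral_cmult_indicator em flip: ennreal_mult)
  also have "\<dots> \<le> (\<integral>\<^sup>+\<eta>\<in>B. (\<integral>\<^sup>+\<theta>\<in>{0..2*pi}. g \<theta> \<eta> \<partial>lborel) \<partial>lborel)"
    using big by (intro nn_integral_mono) (auto simp: indicator_def)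
  also have "\<dots> = (\<integral>\<^sup>+\<eta>. (\<integral>\<^sup>+\<theta>. g \<theta> \<eta> * indicator {0..2*pi} \<theta> * indicator B \<eta> \<partial>lborel) \<partial>lborel)"
    by (simp add: nn_integral_multc)
  also have "\<dots> = (\<integral>\<^sup>+\<theta>. (\<integral>\<^sup>+\<eta>. g \<theta> \<eta> * indicator {0..2*pi} \<theta> * indicator B \<eta> \<partial>lborel) \<partial>lborel)"
    by (rule lborel_pair.Fubini') measurable
  \<comment> \<open>Enlarging the ball to the whole space makes the inner integral invariant, hence
    equal to the integral of \<open>Q\<close>.\<close>
  also have "\<dots> \<le> (\<integral>\<^sup>+\<theta>. (\<integral>\<^sup>+\<eta>. g \<theta> \<eta> * indicator {0..2*pi} \<theta> \<partial>lborel) \<partial>lborel)"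
    by (intro nn_integral_mono) (auto simp: indicator_def)
  also have "\<dots> = (\<integral>\<^sup>+\<theta>\<in>{0..2*pi}. (\<integral>\<^sup>+x. Q x \<partial>lborel) \<partial>lborel)"
  proof -
    have "(\<integral>\<^sup>+\<eta>. g \<theta> \<eta> \<partial>lborel) = (\<integral>\<^sup>+x. Q x \<partial>lborel)" for \<theta>
      unfolding g_def by (rule nn_integral_cis_smult) measurable
    then show ?thesis by (simp add: nn_integral_multc)
  qed
  also have "\<dots> \<le> (\<integral>\<^sup>+\<theta>\<in>{0..2*pi}. ennreal C \<partial>lborel)"
    using int by (intro nn_integral_mono mult_right_mono) auto
  also have "\<dots> = ennreal (2 * pi * C)"
    using \<open>C > 0\<close> by (simp add: nn_integral_cmult_indicator mult.commute flip: ennreal_mult)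
  finally show False using \<open>C > 0\<close> by (simp add: ennreal_le_iff)
qed

text \<open>The inequality \<open>ln t \<le> t - 1\<close> replaces Jensen's inequality for the logarithm of the mean.\<close>

lemma ln_max_le_weighted:
  fixes y :: real
  assumes "y \<ge> 0" "a > 0" "c > 0" "p > 0" "\<epsilon> > 0" "\<epsilon> \<le> a"
  shows "ln (max y (\<epsilon> ^ m * c powr (1/p))) \<le> real m * ln a + (ln c + (y / a ^ m) powr p / c) / p"
proof -
  define G where "G = y / a ^ m"
  have "G \<ge> 0" using assms by (simp add: G_def)
  \<comment> \<open>Both alternatives of the maximum on the left are at most
    \<open>a ^ m * X powr (1/p)\<close>; the second one uses
    \<open>\<epsilon> \<le> a\<close>.\<close>
  define X where "X = max (G powr p) c"
  have "X > 0" using assms by (simp add: X_def)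
  have "max y (\<epsilon> ^ m * c powr (1/p)) \<le> a ^ m * X powr (1/p)"
  proof (rule max.boundedI)
    have "G = (G powr p) powr (1/p)" using \<open>G \<ge> 0\<close> \<open>p > 0\<close> by (simp add: powr_powr)
    also have "\<dots> \<le> X powr (1/p)"
      using assms by (intro powr_mono2) (auto simp: X_def)
    finally show "y \<le> a ^ m * X powr (1/p)" using \<open>a > 0\<close> by (simp add: G_def field_simps)
    show "\<epsilon> ^ m * c powr (1/p) \<le> a ^ m * X powr (1/p)"
      using assms by (intro mult_mono power_mono powr_mono2) (auto simp: X_def)
  qed
  moreover have "0 < max y (\<epsilon> ^ m * c powr (1/p))"
    using assms by (auto simp: less_max_iff_disj)
  ultimately have "ln (max y (\<epsilon> ^ m * c powr (1/p))) \<le> ln (a ^ m * X powr (1/p))"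
    by (intro ln_mono)
  also have "\<dots> = real m * ln a + ln X / p"
    using \<open>a > 0\<close> \<open>X > 0\<close> by (simp add: ln_mult ln_realpow ln_powr)
  also have "ln X \<le> ln c + (G powr p) / c"
  proof (cases "G powr p \<le> c")
    case True
    then show ?thesis using \<open>c > 0\<close> by (simp add: X_def max_def)
  next
    case False
    then have "ln (G powr p / c) \<le> G powr p / c - 1"
      using \<open>c > 0\<close> by (intro ln_le_minus_one divide_pos_pos) auto
    moreover have "ln (G powr p / c) = ln (G powr p) - ln c"
      using False \<open>c > 0\<close> by (intro ln_divide_pos) auto
    ultimately show ?thesis using False by (simp add: X_def max_def)
  qed
  finally show ?thesis using \<open>p > 0\<close> by (simp add: G_def divide_right_mono)
qed

text \<open>On the selected circle, the sub-mean inequality for \<open>ln (cmod F)\<close> is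
  combined with the pointwise bound of \<open>ln (cmod F)\<close> by \<open>m\<close> times the
  logarithm of the truncated \<open>\<phi>\<close> plus an error. Division by \<open>m\<close>
  leaves an error of order \<open>ln C / m\<close>. The deficit below \<open>ln M\<close> is
  nonnegative, so it can be integrated in \<open>ennreal\<close>.\<close>

lemma ex_disc_log_deficit_le:
  fixes \<phi> :: "complex^'n \<Rightarrow> real" and F :: "complex^'n \<Rightarrow> complex"
  assumes "open U" and disc: "\<And>\<eta> \<zeta>. norm \<eta> < r \<Longrightarrow> cmod \<zeta> \<le> 1 \<Longrightarrow> z + \<zeta> *s (w + \<eta>) \<in> U"
    and \<phi> [measurable]: "\<phi> \<in> borel_measurable borel"
    and M: "\<And>\<eta> \<theta>. norm \<eta> < r \<Longrightarrow> \<phi> (z + cis \<theta> *s (w + \<eta>)) \<le> M"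
    and F [measurable]: "F \<in> borel_measurable borel"
    and holo: "\<And>v. (\<lambda>\<zeta>. F (z + \<zeta> *s v)) holomorphic_on {\<zeta>. z + \<zeta> *s v \<in> U}"
    and int: "(\<integral>\<^sup>+x\<in>U. ennreal ((cmod (F x) / max (\<phi> x) \<epsilon> ^ m) powr p) \<partial>lborel) \<le> ennreal C"
    and t: "t > 0" "t ^ m \<le> cmod (F z)"
    and pos: "C > 0" "p > 0" "\<epsilon> > 0" "\<epsilon> \<le> M" "m \<ge> 1" "r > 0"
  shows "\<exists>\<eta>\<in>ball 0 r. (\<integral>\<^sup>+\<theta>\<in>{0..2*pi}. ennreal (ln M - ln (max (\<phi> (z + cis \<theta> *s (w + \<eta>))) \<epsilon>)) \<partial>lborel)
    \<le> ennreal (2 * pi * (ln M - ln t)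
        + 2 * pi / (p * real m) * (ln (2 * C / measure lborel (ball 0 r :: (complex^'n) set)) + 1))"
proof -
  have [measurable]: "U \<in> sets borel" using \<open>open U\<close> by simp
  define \<beta> where "\<beta> = measure lborel (ball 0 r :: (complex^'n) set)"
  have "\<beta> > 0" using \<open>r > 0\<close> by (simp add: \<beta>_def content_ball_pos)
  \<comment> \<open>The selected circle integral of \<open>G\<close> is at most
    \<open>2 * pi * c\<close>, so \<open>c\<close> bounds its mean and the term \<open>G / c\<close>
    contributes at most \<open>2 * pi\<close>.\<close>
  define c where "c = 2 * C / \<beta>"
  have "c > 0" using \<open>C > 0\<close> \<open>\<beta> > 0\<close> by (simp add: c_def)
  define G where "G x = (cmod (F x) / max (\<phi> x) \<epsilon> ^ m) powr p" for x
  have [measurable]: "G \<in> borel_measurable borel" unfolding G_def by measurable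
  obtain \<eta> where \<eta>: "norm \<eta> < r" and
    le: "(\<integral>\<^sup>+\<theta>\<in>{0..2*pi}. (ennreal (G (z + cis \<theta> *s (w + \<eta>))) * indicator U (z + cis \<theta> *s (w + \<eta>))) \<partial>lborel)
      \<le> ennreal (4 * pi * C / \<beta>)"
    using ex_disc_nn_integral_le[of "\<lambda>x. ennreal (G x) * indicator U x" C r z w] int pos
    unfolding \<beta>_def G_def by auto
  define \<gamma> where "\<gamma> \<theta> = z + cis \<theta> *s (w + \<eta>)" for \<theta>
  have \<gamma>U: "\<gamma> \<theta> \<in> U" for \<theta> using disc[OF \<eta>] by (simp add: \<gamma>_def)
  have [measurable]: "\<gamma> \<in> borel_measurable borel"
    unfolding \<gamma>_def
    by (intro borel_measurable_continuous_onI continuous_intros continuous_on_vector_smult)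
  have leG: "(\<integral>\<^sup>+\<theta>\<in>{0..2*pi}. ennreal (G (\<gamma> \<theta>)) \<partial>lborel) \<le> ennreal (2 * pi * c)"
    using le \<gamma>U by (simp add: \<gamma>_def c_def mult.assoc)
  \<comment> \<open>The cut-off that \<open>ln_max_le_weighted\<close> produces when
    \<open>\<phi>\<close> is truncated at \<open>\<epsilon>\<close>.\<close>
  define \<delta> where "\<delta> = \<epsilon> ^ m * c powr (1/p)"
  have "\<delta> > 0" using pos \<open>c > 0\<close> by (simp add: \<delta>_def)
  define v where "v = (\<lambda>\<theta>. ln (max (cmod (F (\<gamma> \<theta>))) \<delta>))"
  define h where "h \<theta> = ln M - ln (max (\<phi> (\<gamma> \<theta>)) \<epsilon>)" for \<theta>
  define S where "S = {\<zeta>. z + \<zeta> *s (w + \<eta>) \<in> U}"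
  have contS: "continuous_on UNIV (\<lambda>\<zeta>. z + \<zeta> *s (w + \<eta>))"
    by (intro continuous_intros continuous_on_vector_smult)
  have "open S" using open_vimage[OF \<open>open U\<close> contS] by (simp add: S_def vimage_def)
  have cbS: "cball 0 1 \<subseteq> S" using disc[OF \<eta>] by (auto simp: S_def)
  have holS: "(\<lambda>\<zeta>. F (z + \<zeta> *s (w + \<eta>))) holomorphic_on S" unfolding S_def by (rule holo)
  have Fz: "0 < cmod (F z)" using t by (meson less_le_trans zero_less_power)
  have sub: "2 * pi * ln (cmod (F z)) \<le> integral {0..2*pi} v"
    using ln_norm_le_circle_integral[OF holS \<open>open S\<close> cbS \<open>\<delta> > 0\<close>] Fz
    by (simp add: v_def \<gamma>_def)
  have v_cont: "continuous_on {0..2*pi} v"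
  proof -
    have "continuous_on {0..2*pi} (\<lambda>\<theta>. F (z + cis \<theta> *s (w + \<eta>)))"
      by (rule continuous_on_compose2[OF holomorphic_on_imp_continuous_on[OF holS]])
        (use cbS in \<open>auto intro!: continuous_intros\<close>)
    then show ?thesis
      unfolding v_def \<gamma>_def using \<open>\<delta> > 0\<close>
      by (intro continuous_on_ln continuous_on_max continuous_on_norm continuous_on_const)
        (auto simp: max_def split: if_splits)
  qed
  have [measurable]: "v \<in> borel_measurable borel" "h \<in> borel_measurable borel"
    unfolding v_def h_def by measurable
  define k where "k = real m * ln M + ln c / p"
  \<comment> \<open>A constant that makes both \<open>v \<theta> + A\<close> and
    \<open>k + A\<close> nonnegative, so that the comparison can be integrated in
    \<open>ennreal\<close>; it cancels at the end.\<close>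
  define A where "A = \<bar>ln \<delta>\<bar> + \<bar>k\<bar>"
  have pw: "real m * h \<theta> + (v \<theta> + A) \<le> (k + A) + 1 / (p * c) * G (\<gamma> \<theta>)" for \<theta>
    using ln_max_le_weighted[of "cmod (F (\<gamma> \<theta>))" "max (\<phi> (\<gamma> \<theta>)) \<epsilon>" c p \<epsilon> m] pos \<open>c > 0\<close>
    by (simp add: h_def v_def k_def G_def \<delta>_def algebra_simps add_divide_distrib less_max_iff_disj)
  have h_nonneg: "0 \<le> h \<theta>" for \<theta>
    using M[OF \<eta>, of \<theta>] pos by (simp add: h_def \<gamma>_def less_max_iff_disj)
  have "ln \<delta> \<le> v \<theta>" for \<theta> using \<open>\<delta> > 0\<close> by (simp add: v_def)
  then have vA: "0 \<le> v \<theta> + A" for \<theta> unfolding A_def by (smt (verit))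
  have kA: "0 \<le> k + A" by (simp add: A_def)
  have G_nonneg: "0 \<le> G x" for x by (simp add: G_def)
  have v_hi: "((\<lambda>\<theta>. v \<theta> + A) has_integral (integral {0..2*pi} v + 2 * pi * A)) {0..2*pi}"
    using has_integral_add[OF integrable_integral[OF integrable_continuous_interval[OF v_cont]] has_integral_const_real[of A 0 "2*pi"]]
    by simp
  have v_nn: "(\<integral>\<^sup>+\<theta>\<in>{0..2*pi}. ennreal (v \<theta> + A) \<partial>lborel) = ennreal (integral {0..2*pi} v + 2 * pi * A)"
  proof -
    have "(\<integral>\<^sup>+\<theta>\<in>{0..2*pi}. ennreal (v \<theta> + A) \<partial>lborel)
        = (\<integral>\<^sup>+\<theta>. ennreal (indicator {0..2*pi} \<theta> * (v \<theta> + A)) \<partial>lborel)"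
      by (intro nn_integral_cong) (auto simp: indicator_def)
    then show ?thesis using nn_integral_has_integral_lebesgue[OF vA v_hi] by simp
  qed
  have split: "ennreal (real m * h \<theta> + (v \<theta> + A)) = ennreal (real m) * ennreal (h \<theta>) + ennreal (v \<theta> + A)" for \<theta>
    using h_nonneg[of \<theta>] vA[of \<theta>] by (subst ennreal_plus) (auto simp: ennreal_mult)
  define H where "H = (\<integral>\<^sup>+\<theta>\<in>{0..2*pi}. ennreal (h \<theta>) \<partial>lborel)"
  have "ennreal (real m) * H + ennreal (integral {0..2*pi} v + 2 * pi * A)
      = (\<integral>\<^sup>+\<theta>\<in>{0..2*pi}. ennreal (real m * h \<theta> + (v \<theta> + A)) \<partial>lborel)"
    unfolding H_def v_nn[symmetric]
    by (subst nn_integral_cmult[symmetric], measurable, subst nn_integral_add[symmetric])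
      (auto intro!: nn_integral_cong simp: split indicator_def)
  also have "\<dots> \<le> (\<integral>\<^sup>+\<theta>\<in>{0..2*pi}. (ennreal (k + A) + ennreal (1 / (p * c)) * ennreal (G (\<gamma> \<theta>))) \<partial>lborel)"
    using pw kA G_nonneg pos \<open>c > 0\<close>
    by (intro nn_integral_mono mult_right_mono) (auto simp flip: ennreal_plus ennreal_mult intro!: ennreal_leI)
  also have "\<dots> = (\<integral>\<^sup>+\<theta>\<in>{0..2*pi}. ennreal (k + A) \<partial>lborel)
      + ennreal (1 / (p * c)) * (\<integral>\<^sup>+\<theta>\<in>{0..2*pi}. ennreal (G (\<gamma> \<theta>)) \<partial>lborel)"
    by (subst nn_integral_cmult[symmetric], measurable, subst nn_integral_add[symmetric])
      (auto intro!: nn_integral_cong simp: indicator_def)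
  also have "\<dots> \<le> ennreal (2 * pi * (k + A)) + ennreal (1 / (p * c)) * ennreal (2 * pi * c)"
    using leG kA by (intro add_mono mult_left_mono) (simp_all add: nn_integral_cmult_indicator mult.commute flip: ennreal_mult)
  also have "\<dots> = ennreal (2 * pi * (k + A) + 2 * pi / p)"
    using pos \<open>c > 0\<close> kA by (simp flip: ennreal_mult ennreal_plus)
  finally have main: "ennreal (real m) * H + ennreal (integral {0..2*pi} v + 2 * pi * A)
      \<le> ennreal (2 * pi * (k + A) + 2 * pi / p)" .
  then have "ennreal (real m) * H \<noteq> \<infinity>" by (auto simp: top_unique)
  then have "H \<noteq> \<infinity>" using \<open>m \<ge> 1\<close> by (auto simp: ennreal_mult_top)
  then obtain H' where H': "H = ennreal H'" "H' \<ge> 0" by (cases H) auto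
  have "0 \<le> integral {0..2*pi} v + 2 * pi * A"
    using has_integral_nonneg[OF v_hi] vA by auto
  then have "real m * H' + (integral {0..2*pi} v + 2 * pi * A) \<le> 2 * pi * (k + A) + 2 * pi / p"
    using main H' kA pos by (simp add: ennreal_le_iff flip: ennreal_mult ennreal_plus)
  moreover have "real m * ln t \<le> ln (cmod (F z))"
    using t Fz by (subst ln_realpow[symmetric]) (auto intro: ln_mono)
  then have "2 * pi * (real m * ln t) \<le> 2 * pi * ln (cmod (F z))" by (intro mult_left_mono) auto
  ultimately have "real m * H' \<le> 2 * pi * k + 2 * pi / p - 2 * pi * (real m * ln t)"
    using sub unfolding distrib_left by linarith
  then have "H' \<le> 2 * pi * (ln M - ln t) + 2 * pi / (p * real m) * (ln c + 1)"
    using pos by (simp add: k_def field_simps)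
  then show ?thesis
    using \<eta> H' unfolding H_def h_def \<gamma>_def c_def \<beta>_def
    by (intro bexI[of _ \<eta>]) (auto intro: ennreal_leI)
qed

section \<open>From logarithmic deficits to circle means\<close>

lemma enn_ln_ennreal_power2:
  "0 \<le> r \<Longrightarrow> enn_ln ((ennreal r)\<^sup>2) = (if r = 0 then - \<infinity> else ereal (2 * ln r))"
  by (auto simp: enn_ln_def ennreal_power ln_realpow)

text \<open>\<open>circle_mean\<close> subtracts the integral of the negative part \<open>b\<close>
  from that of the positive part \<open>a\<close>. The identity \<open>pw\<close>, which contains no
  subtraction of possibly infinite values, converts the bound on the deficit \<open>H\<close> into
  one on this difference. The factor 2 comes from the square.\<close>

lemma circle_mean_enn_ln_ge:
  fixes g :: "real \<Rightarrow> real"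
  assumes [measurable]: "g \<in> borel_measurable borel" and g: "\<And>\<theta>. 0 \<le> g \<theta>" "\<And>\<theta>. g \<theta> \<le> M"
    and "M \<ge> 1" and "l \<le> ln M"
    and le: "(\<integral>\<^sup>+\<theta>\<in>{0..2*pi}. (if g \<theta> = 0 then \<infinity> else ennreal (ln M - ln (g \<theta>))) \<partial>lborel)
      \<le> ennreal (2 * pi * (ln M - l))"
  shows "ereal (2 * l) \<le> circle_mean (\<lambda>\<theta>. enn_ln ((ennreal (g \<theta>))\<^sup>2))"
proof -
  define H where "H \<theta> = (if g \<theta> = 0 then \<infinity> else ennreal (ln M - ln (g \<theta>)))" for \<theta>
  define a b where "a \<theta> = e2ennreal (enn_ln ((ennreal (g \<theta>))\<^sup>2))"
    and "b \<theta> = e2ennreal (- enn_ln ((ennreal (g \<theta>))\<^sup>2))" for \<theta>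
  have v: "enn_ln ((ennreal (g \<theta>))\<^sup>2) = (if g \<theta> = 0 then - \<infinity> else ereal (2 * ln (g \<theta>)))" for \<theta>
    using g(1)[of \<theta>] by (rule enn_ln_ennreal_power2)
  have ab: "a \<theta> = (if g \<theta> = 0 then 0 else ennreal (2 * ln (g \<theta>)))"
    "b \<theta> = (if g \<theta> = 0 then \<infinity> else ennreal (- 2 * ln (g \<theta>)))" for \<theta>
    by (auto simp: a_def b_def v e2ennreal_neg e2ennreal_ereal)
  have [measurable]: "H \<in> borel_measurable borel" "a \<in> borel_measurable borel" "b \<in> borel_measurable borel"
    unfolding H_def ab by measurable
  have lM: "0 \<le> ln M" using \<open>M \<ge> 1\<close> by simp
  have two: "ennreal (2 * x) = 2 * ennreal x" if "0 \<le> x" for x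
    using ennreal_mult[of 2 x] that by simp
  \<comment> \<open>Both sides are infinite where \<open>g\<close> vanishes; elsewhere
    \<open>a\<close> or \<open>b\<close> is zero.\<close>
  have pw: "b \<theta> + ennreal (2 * ln M) = a \<theta> + 2 * H \<theta>" for \<theta>
  proof (cases "g \<theta> = 0")
    case True
    then show ?thesis by (simp add: ab H_def ennreal_mult_top)
  next
    case False
    then have "0 < g \<theta>" using g(1)[of \<theta>] by simp
    then have lg: "ln (g \<theta>) \<le> ln M" using g(2)[of \<theta>] by (intro ln_mono) auto
    have H2: "2 * H \<theta> = ennreal (2 * (ln M - ln (g \<theta>)))"
      by (subst two) (use False lg in \<open>auto simp: H_def\<close>)
    show ?thesis
    proof (cases "ln (g \<theta>) \<ge> 0")
      case True
      then have "b \<theta> = 0" using False by (simp add: ab ennreal_neg)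
      then show ?thesis unfolding H2 using True False lg
        by (simp add: ab flip: ennreal_plus)
    next
      case neg: False
      then have "a \<theta> = 0" using False by (simp add: ab ennreal_neg)
      then show ?thesis unfolding H2 using neg False lg lM
        by (simp add: ab flip: ennreal_plus)
    qed
  qed
  define IA IB IH where "IA = (\<integral>\<^sup>+\<theta>\<in>{0..2*pi}. a \<theta> \<partial>lborel)"
    and "IB = (\<integral>\<^sup>+\<theta>\<in>{0..2*pi}. b \<theta> \<partial>lborel)" and "IH = (\<integral>\<^sup>+\<theta>\<in>{0..2*pi}. H \<theta> \<partial>lborel)"
  have "IB + ennreal (4 * pi * ln M) = (\<integral>\<^sup>+\<theta>\<in>{0..2*pi}. (b \<theta> + ennreal (2 * ln M)) \<partial>lborel)"
  proof -
    have "(\<integral>\<^sup>+\<theta>\<in>{0..2*pi}. ennreal (2 * ln M) \<partial>lborel) = ennreal (4 * pi * ln M)"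
      using lM by (simp add: nn_integral_cmult_indicator mult_ac flip: ennreal_mult)
    then show ?thesis unfolding IB_def by (simp add: distrib_right nn_integral_add)
  qed
  also have "\<dots> = IA + 2 * IH"
    unfolding pw IA_def IH_def
    by (simp add: distrib_right nn_integral_add mult.assoc nn_integral_cmult)
  finally have eq: "IB + ennreal (4 * pi * ln M) = IA + 2 * IH" .
  have IHle: "IH \<le> ennreal (2 * pi * (ln M - l))" using le by (simp add: IH_def H_def)
  then have "IH \<noteq> \<infinity>" by (auto simp: top_unique)
  have "a \<theta> \<le> ennreal (2 * ln M)" for \<theta>
    using g[of \<theta>] by (auto simp: ab intro!: ennreal_leI ln_mono)
  then have "IA \<le> (\<integral>\<^sup>+\<theta>\<in>{0..2*pi}. ennreal (2 * ln M) \<partial>lborel)"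
    unfolding IA_def by (intro nn_integral_mono mult_right_mono) auto
  also have "\<dots> < \<infinity>" by (simp add: nn_integral_cmult_indicator ennreal_mult_less_top)
  finally have "IA \<noteq> \<infinity>" by simp
  then obtain A where A: "IA = ennreal A" "A \<ge> 0" by (cases IA) auto
  obtain Hr where Hr: "IH = ennreal Hr" "Hr \<ge> 0" using \<open>IH \<noteq> \<infinity>\<close> by (cases IH) auto
  have "IB + ennreal (4 * pi * ln M) = ennreal (A + 2 * Hr)"
    unfolding eq A(1) Hr(1) two[OF Hr(2), symmetric] using A(2) Hr(2) by simp
  \<comment> \<open>A finite deficit forces the negative part to be integrable, so that
    \<open>circle_mean\<close> subtracts real numbers.\<close>
  then have "IB \<noteq> \<infinity>" by auto
  then obtain B where B: "IB = ennreal B" "B \<ge> 0" by (cases IB) auto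
  have "ennreal (B + 4 * pi * ln M) = ennreal (A + 2 * Hr)"
    using eq A B Hr lM by (simp add: ennreal_mult)
  then have sum: "B + 4 * pi * ln M = A + 2 * Hr"
    using A B Hr lM by (subst (asm) ennreal_inj) auto
  have "Hr \<le> 2 * pi * (ln M - l)"
    using IHle Hr \<open>l \<le> ln M\<close> by (simp add: ennreal_le_iff)
  then have "4 * pi * l \<le> A - B" using sum by (simp add: algebra_simps)
  then have "2 * l \<le> (A - B) / (2 * pi)" by (simp add: field_simps)
  then show ?thesis
    unfolding circle_mean_def a_def[symmetric] b_def[symmetric] IA_def[symmetric] IB_def[symmetric]
    by (simp add: A B)
qed

text \<open>The sublevel sets at natural numbers are an open cover of \<open>K\<close>.\<close>

lemma usc_bounded_on_compact:
  fixes \<phi> :: "'a::topological_space \<Rightarrow> real"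
  assumes "compact K" "K \<subseteq> U" and usc: "\<And>c. open {x\<in>U. \<phi> x < c}"
  shows "\<exists>M. \<forall>x\<in>K. \<phi> x < M"
proof -
  have "K \<subseteq> (\<Union>n\<in>UNIV. {x\<in>U. \<phi> x < real n})"
    using \<open>K \<subseteq> U\<close> reals_Archimedean2 by blast
  then obtain N where "finite N" "K \<subseteq> (\<Union>n\<in>N. {x\<in>U. \<phi> x < real n})"
    by (rule compactE_image[OF \<open>compact K\<close>, rotated]) (use usc in auto)
  then have "\<forall>x\<in>K. \<phi> x < real (Max N)"
    by (auto dest!: subsetD) (meson Max_ge less_le_trans of_nat_le_iff)
  then show ?thesis by blast
qed

text \<open>For each \<open>j\<close>, a disc within \<open>r j\<close> of the direction
  \<open>w\<close> and a truncation at \<open>\<epsilon> j\<close> are used, with \<open>m\<close>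
  so large that the error drops below \<open>\<epsilon> j\<close>. As \<open>j\<close> grows,
  Fatou's lemma applies to the deficits, whose lower limit dominates \<open>H\<close> by upper
  semicontinuity.\<close>

lemma log_le_circle_mean:
  fixes \<phi> :: "complex^'n \<Rightarrow> real" and C :: "nat \<Rightarrow> real"
  assumes "open U" and disc: "\<And>\<zeta>. cmod \<zeta> \<le> 1 \<Longrightarrow> z + \<zeta> *s w \<in> U"
    and \<phi> [measurable]: "\<phi> \<in> borel_measurable borel" and \<phi>_nonneg: "\<And>x. 0 \<le> \<phi> x"
    and usc: "\<And>c. open {x\<in>U. \<phi> x < c}"
    and pos: "t > 0" "p > 0" "\<And>m. m \<ge> 1 \<Longrightarrow> C m > 0"
    and C: "(\<lambda>m. ln (C m) / real m) \<longlonglongrightarrow> 0"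
    and ex: "\<And>m. m \<ge> 1 \<Longrightarrow> \<exists>F\<in>borel_measurable borel.
      (\<forall>v. (\<lambda>\<zeta>. F (z + \<zeta> *s v)) holomorphic_on {\<zeta>. z + \<zeta> *s v \<in> U}) \<and> t ^ m \<le> cmod (F z) \<and>
      (\<forall>\<epsilon>>0. (\<integral>\<^sup>+x\<in>U. ennreal ((cmod (F x) / max (\<phi> x) \<epsilon> ^ m) powr p) \<partial>lborel) \<le> ennreal (C m))"
  shows "ereal (2 * ln t) \<le> circle_mean (\<lambda>\<theta>. enn_ln ((ennreal (\<phi> (z + cis \<theta> *s w)))\<^sup>2))"
proof -
  define A where "A = (\<lambda>\<zeta>. z + \<zeta> *s w) ` cball 0 1"
  have "compact A" unfolding A_def
    by (intro compact_continuous_image continuous_intros continuous_on_vector_smult) auto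
  moreover have "A \<subseteq> U" using disc by (auto simp: A_def)
  ultimately obtain R where "R > 0" and R: "(\<Union>x\<in>A. cball x R) \<subseteq> U"
    using compact_subset_open_imp_cball_epsilon_subset \<open>open U\<close> by blast
  \<comment> \<open>A compact neighbourhood of the closed disc that contains the discs in all nearby
    directions, so that a single bound \<open>M\<close> serves for all of them.\<close>
  define K where "K = {x + y | x y. x \<in> A \<and> y \<in> cball 0 R}"
  have "compact K" unfolding K_def by (rule compact_sums[OF \<open>compact A\<close>]) auto
  have K: "z + \<zeta> *s (w + \<eta>) \<in> K" if "norm \<eta> \<le> R" "cmod \<zeta> \<le> 1" for \<eta> \<zeta>
  proof -
    have "norm (\<zeta> *s \<eta>) \<le> 1 * R"
      unfolding norm_vector_smult using that by (intro mult_mono) auto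
    then show ?thesis
      using that unfolding K_def A_def mem_Collect_eq
      by (intro exI[of _ "z + \<zeta> *s w"] exI[of _ "\<zeta> *s \<eta>"]) (auto simp: vector_add_ldistrib add.assoc)
  qed
  have "K \<subseteq> U"
  proof
    fix x assume "x \<in> K"
    then obtain a y where "x = a + y" "a \<in> A" "norm y \<le> R" by (auto simp: K_def)
    then have "x \<in> cball a R" by (simp add: dist_norm)
    then show "x \<in> U" using R \<open>a \<in> A\<close> by blast
  qed
  obtain M0 where M0: "\<And>x. x \<in> K \<Longrightarrow> \<phi> x < M0"
    using usc_bounded_on_compact[OF \<open>compact K\<close> \<open>K \<subseteq> U\<close> usc] by blast
  \<comment> \<open>The entry 1 ensures \<open>ln M \<ge> 0\<close> and
    \<open>\<epsilon> j \<le> M\<close>; the entry \<open>t\<close> makes \<open>ln M - ln t\<close>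
    nonnegative.\<close>
  define M where "M = max 1 (max t M0)"
  have M: "M \<ge> 1" "t \<le> M" "\<And>x. x \<in> K \<Longrightarrow> \<phi> x \<le> M"
    using M0 by (auto simp: M_def less_imp_le le_max_iff_disj)
  define r where "r j = R / real (Suc j)" for j
  define \<epsilon> where "\<epsilon> j = 1 / real (Suc j)" for j
  have r: "0 < r j" "r j \<le> R" and \<epsilon>: "0 < \<epsilon> j" "\<epsilon> j \<le> 1" for j
    using \<open>R > 0\<close> by (auto simp: r_def \<epsilon>_def field_simps)
  have \<epsilon>_lim: "\<epsilon> \<longlonglongrightarrow> 0"
    unfolding \<epsilon>_def using LIMSEQ_inverse_real_of_nat by (simp add: inverse_eq_divide)
  have "(\<lambda>j. R * \<epsilon> j) \<longlonglongrightarrow> R * 0" by (intro tendsto_intros \<epsilon>_lim)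
  moreover have "r = (\<lambda>j. R * \<epsilon> j)" by (auto simp: r_def \<epsilon>_def)
  ultimately have r_lim: "r \<longlonglongrightarrow> 0" by simp
  define h where "h j \<eta> \<theta> = ennreal (ln M - ln (max (\<phi> (z + cis \<theta> *s (w + \<eta>))) (\<epsilon> j)))" for j \<eta> \<theta>
  have "\<exists>\<eta>\<in>ball 0 (r j). (\<integral>\<^sup>+\<theta>\<in>{0..2*pi}. h j \<eta> \<theta> \<partial>lborel) \<le> ennreal (2 * pi * (ln M - ln t) + \<epsilon> j)" for j
  proof -
    define \<beta> where "\<beta> = measure lborel (ball 0 (r j) :: (complex^'n) set)"
    have "\<beta> > 0" using r(1)[of j] by (simp add: \<beta>_def content_ball_pos)
    \<comment> \<open>The volume \<open>\<beta>\<close> of the small ball is fixed before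
      \<open>m\<close> is chosen, so its logarithm is also negligible after division by
      \<open>m\<close>.\<close>
    have "(\<lambda>m. 2 * pi / p * (ln (C m) / real m + (ln (2 / \<beta>) + 1) * (1 / real m))) \<longlonglongrightarrow> 2 * pi / p * (0 + (ln (2 / \<beta>) + 1) * 0)"
      by (intro tendsto_intros C lim_1_over_n)
    then have "eventually (\<lambda>m. 2 * pi / p * (ln (C m) / real m + (ln (2 / \<beta>) + 1) * (1 / real m)) < \<epsilon> j) sequentially"
      using \<epsilon>(1)[of j] by (intro order_tendstoD(2)) auto
    then obtain m where "m \<ge> 1" and m: "2 * pi / p * (ln (C m) / real m + (ln (2 / \<beta>) + 1) * (1 / real m)) < \<epsilon> j"
      using eventually_conj[OF _ eventually_ge_at_top[of 1]] eventually_happens'[OF sequentially_bot] by fast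
    have "ln (2 * C m / \<beta>) = ln (C m) + ln (2 / \<beta>)"
      using pos(3)[OF \<open>m \<ge> 1\<close>] \<open>\<beta> > 0\<close> ln_mult_pos[of "C m" "2 / \<beta>"] by (simp add: mult.commute)
    then have err: "2 * pi / (p * real m) * (ln (2 * C m / \<beta>) + 1) < \<epsilon> j"
      using m by (simp add: add_divide_distrib algebra_simps)
    obtain F where "F \<in> borel_measurable borel"
      "\<And>v. (\<lambda>\<zeta>. F (z + \<zeta> *s v)) holomorphic_on {\<zeta>. z + \<zeta> *s v \<in> U}" "t ^ m \<le> cmod (F z)"
      "(\<integral>\<^sup>+x\<in>U. ennreal ((cmod (F x) / max (\<phi> x) (\<epsilon> j) ^ m) powr p) \<partial>lborel) \<le> ennreal (C m)"
      using ex[OF \<open>m \<ge> 1\<close>] \<epsilon>(1)[of j] by blast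
    then obtain \<eta> where "\<eta> \<in> ball 0 (r j)" and le: "(\<integral>\<^sup>+\<theta>\<in>{0..2*pi}. h j \<eta> \<theta> \<partial>lborel)
        \<le> ennreal (2 * pi * (ln M - ln t) + 2 * pi / (p * real m) * (ln (2 * C m / \<beta>) + 1))"
      unfolding h_def \<beta>_def
      using ex_disc_log_deficit_le[of U "r j" z w \<phi> M F "\<epsilon> j" m p "C m" t] \<open>open U\<close> K \<open>K \<subseteq> U\<close> M pos r[of j] \<epsilon>[of j] \<open>m \<ge> 1\<close> \<phi>
      by (smt (verit) norm_cis subsetD)
    show ?thesis
      by (intro bexI[OF _ \<open>\<eta> \<in> ball 0 (r j)\<close>] order_trans[OF le] ennreal_leI) (use err in linarith)
  qed
  then obtain \<eta> where \<eta>: "\<And>j. norm (\<eta> j) < r j"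
    and le: "\<And>j. (\<integral>\<^sup>+\<theta>\<in>{0..2*pi}. h j (\<eta> j) \<theta> \<partial>lborel) \<le> ennreal (2 * pi * (ln M - ln t) + \<epsilon> j)"
    by (simp add: Bex_def) metis
  have \<eta>_lim: "\<eta> \<longlonglongrightarrow> 0"
    by (rule tendsto_norm_zero_cancel, rule tendsto_sandwich[OF _ _ tendsto_const r_lim])
      (auto intro!: always_eventually less_imp_le[OF \<eta>])
  define g where "g \<theta> = \<phi> (z + cis \<theta> *s w)" for \<theta>
  have meas [measurable]: "(\<lambda>\<theta>. z + cis \<theta> *s (w + y)) \<in> borel_measurable borel" for y
    by (intro borel_measurable_continuous_onI continuous_intros continuous_on_vector_smult)
  have [measurable]: "h j y \<in> borel_measurable borel" for j y
    unfolding h_def by measurable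
  have [measurable]: "g \<in> borel_measurable borel"
    unfolding g_def using meas[of 0] by simp
  define H where "H \<theta> = (if g \<theta> = 0 then \<infinity> else ennreal (ln M - ln (g \<theta>)))" for \<theta>
  \<comment> \<open>Upper semicontinuity bounds the limit of \<open>\<phi>\<close> along the
    perturbed points from above, hence the limit of the deficits from below.\<close>
  have H_le: "H \<theta> * indicator {0..2*pi} \<theta> \<le> liminf (\<lambda>j. h j (\<eta> j) \<theta> * indicator {0..2*pi} \<theta>)" for \<theta>
  proof (cases "\<theta> \<in> {0..2*pi}")
    case True
    have "H \<theta> \<le> liminf (\<lambda>j. h j (\<eta> j) \<theta>)"
      unfolding le_Liminf_iff
    proof (intro allI impI)
      fix y assume "y < H \<theta>"
      then obtain b where b: "y = ennreal b" "b \<ge> 0" by (cases y) auto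
      \<comment> \<open>The value of the truncated \<open>\<phi>\<close> at which the deficit equals
        \<open>b\<close>; smaller values give a deficit above \<open>b\<close>.\<close>
      define q where "q = exp (ln M - b)"
      have "g \<theta> < q"
      proof (cases "g \<theta> = 0")
        case False
        then have "g \<theta> > 0" using \<phi>_nonneg by (simp add: g_def less_le)
        moreover have "b < ln M - ln (g \<theta>)"
          using \<open>y < H \<theta>\<close> b False by (simp add: H_def ennreal_less_iff)
        then have "ln (g \<theta>) < ln M - b" by simp
        ultimately show ?thesis unfolding q_def by (metis exp_less_mono exp_ln)
      qed (simp add: q_def)
      have "((\<lambda>j. z + cis \<theta> *s (w + \<eta> j)) \<longlongrightarrow> z + cis \<theta> *s (w + 0)) sequentially"
        by (intro tendsto_intros bounded_bilinear.tendsto[OF bounded_bilinear_vector_smult] \<eta>_lim)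
      then have "eventually (\<lambda>j. z + cis \<theta> *s (w + \<eta> j) \<in> {x\<in>U. \<phi> x < q}) sequentially"
        using \<open>g \<theta> < q\<close> disc[of "cis \<theta>"] by (intro topological_tendstoD[OF _ usc]) (auto simp: g_def)
      moreover have "eventually (\<lambda>j. \<epsilon> j < q) sequentially"
        using \<epsilon>_lim by (rule order_tendstoD) (simp add: q_def)
      ultimately show "eventually (\<lambda>j. y < h j (\<eta> j) \<theta>) sequentially"
      proof eventually_elim
        case (elim j)
        then have "ln (max (\<phi> (z + cis \<theta> *s (w + \<eta> j))) (\<epsilon> j)) < ln q"
          using \<epsilon>(1)[of j] by (subst ln_less_cancel_iff) (auto simp: less_max_iff_disj q_def)
        then show ?case using b by (simp add: h_def q_def ennreal_less_iff)
      qed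
    qed
    then show ?thesis using True by simp
  qed simp
  have lt: "0 \<le> ln M - ln t" using M pos by (simp add: ln_mono)
  have "(\<integral>\<^sup>+\<theta>\<in>{0..2*pi}. H \<theta> \<partial>lborel)
      \<le> (\<integral>\<^sup>+\<theta>. liminf (\<lambda>j. h j (\<eta> j) \<theta> * indicator {0..2*pi} \<theta>) \<partial>lborel)"
    by (intro nn_integral_mono H_le)
  also have "\<dots> \<le> liminf (\<lambda>j. \<integral>\<^sup>+\<theta>\<in>{0..2*pi}. h j (\<eta> j) \<theta> \<partial>lborel)"
    by (intro nn_integral_liminf) measurable
  also have "\<dots> \<le> liminf (\<lambda>j. ennreal (2 * pi * (ln M - ln t) + \<epsilon> j))"
    by (intro Liminf_mono always_eventually allI le)
  also have "\<dots> = ennreal (2 * pi * (ln M - ln t) + 0)"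
    by (intro lim_imp_Liminf tendsto_ennrealI tendsto_intros \<epsilon>_lim) simp
  finally have "(\<integral>\<^sup>+\<theta>\<in>{0..2*pi}. H \<theta> \<partial>lborel) \<le> ennreal (2 * pi * (ln M - ln t))" by simp
  then show ?thesis
    using K[of 0] \<open>R > 0\<close> M \<phi>_nonneg lt
    unfolding H_def g_def by (intro circle_mean_enn_ln_ge[of _ M]) (auto simp flip: g_def[abs_def])
qed


section \<open>Sections of holomorphic vector bundles\<close>

text \<open>Complex-linearity of the derivative \<open>L\<close> makes \<open>L v\<close> the
  one-variable complex derivative along the line.\<close>

lemma holomorphic_map_on_line:
  fixes G :: "complex^'n \<Rightarrow> complex"
  assumes "holomorphic_map_on U G"
  shows "(\<lambda>\<zeta>. G (z + \<zeta> *s v)) holomorphic_on {\<zeta>. z + \<zeta> *s v \<in> U}"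
  unfolding holomorphic_on_def
proof
  fix \<zeta> assume "\<zeta> \<in> {\<zeta>. z + \<zeta> *s v \<in> U}"
  then obtain L where L: "(G has_derivative L) (at (z + \<zeta> *s v))" "\<And>c v. L (c *s v) = c *\<^sub>C L v"
    using assms unfolding holomorphic_map_on_def by blast
  have "((\<lambda>\<zeta>. z + \<zeta> *s v) has_derivative (\<lambda>h. h *s v)) (at \<zeta>)"
    by (auto intro!: derivative_eq_intros
        bounded_linear.has_derivative[OF bounded_bilinear.bounded_linear_left[OF bounded_bilinear_vector_smult]])
  from has_derivative_compose[OF this L(1)]
  have "((\<lambda>\<zeta>. G (z + \<zeta> *s v)) has_field_derivative L v) (at \<zeta>)"
    by (simp add: has_field_derivative_def L(2) scaleC_complex_def mult_commute_abs)
  then show "(\<lambda>\<zeta>. G (z + \<zeta> *s v)) field_differentiable at \<zeta> within {\<zeta>. z + \<zeta> *s v \<in> U}"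
    using field_differentiable_def field_differentiable_at_within by blast
qed

locale vector_bundle =
  fixes D :: "(complex^'n) set" and E :: "(complex^'n, 'e, 'h::complex_hilbert) vbundle"
  assumes holomorphic_bundle: "holomorphic_vector_bundle D E"
begin

lemma chart_at:
  assumes "x \<in> D"
  obtains V \<psi> where "(V, \<psi>) \<in> atlas E" "x \<in> V"
proof -
  have "x \<in> (\<Union>(U, \<phi>)\<in>atlas E. U)"
    using assms holomorphic_bundle by (simp add: holomorphic_vector_bundle_def)
  then show thesis using that by auto
qed

lemma chart:
  assumes "(V, \<psi>) \<in> atlas E"
  shows open_chart: "open V" and bij_betw_chart: "x \<in> V \<Longrightarrow> bij_betw \<psi> (fibre E x) UNIV"
proof -
  have "\<forall>(V, \<psi>)\<in>atlas E. open V \<and> (\<forall>x\<in>V. bij_betw \<psi> (fibre E x) UNIV)"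
    using holomorphic_bundle by (simp add: holomorphic_vector_bundle_def)
  from bspec[OF this assms] show "open V" "x \<in> V \<Longrightarrow> bij_betw \<psi> (fibre E x) UNIV" by auto
qed

lemma transition:
  assumes "(U, \<phi>) \<in> atlas E" "(V, \<psi>) \<in> atlas E" "x \<in> U" "x \<in> V"
  obtains g where "complex_linear g" "\<And>v. v \<in> fibre E x \<Longrightarrow> \<psi> v = blinfun_apply g (\<phi> v)"
proof -
  have "\<forall>(U, \<phi>)\<in>atlas E. \<forall>(V, \<psi>)\<in>atlas E.
        \<exists>g :: complex^'n \<Rightarrow> 'h \<Rightarrow>\<^sub>L 'h. holomorphic_map_on (U \<inter> V) g \<and>
          (\<forall>x\<in>U \<inter> V. complex_linear (g x) \<and> (\<forall>v\<in>fibre E x. \<psi> v = blinfun_apply (g x) (\<phi> v)))"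
    using holomorphic_bundle by (simp add: holomorphic_vector_bundle_def)
  from bspec[OF this assms(1), simplified, THEN bspec, OF assms(2)] show thesis
    using that assms(3,4) by auto
qed

text \<open>Justifies the definite description in \<open>fibre_scale\<close>: bijectivity of one
  chart determines the vector, and complex-linear transition maps carry the equation to all other
  charts.\<close>

lemma fibre_scale_unique:
  assumes "x \<in> D" and v: "v \<in> fibre E x"
  shows "\<exists>!w. w \<in> fibre E x \<and> (\<forall>(U, \<phi>)\<in>atlas E. x \<in> U \<longrightarrow> \<phi> w = c *\<^sub>C \<phi> v)"
proof -
  obtain V \<psi> where chart: "(V, \<psi>) \<in> atlas E" "x \<in> V" using chart_at[OF \<open>x \<in> D\<close>] .
  note bij = bij_betw_chart[OF chart]
  then obtain w where w: "w \<in> fibre E x" "\<psi> w = c *\<^sub>C \<psi> v"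
    unfolding bij_betw_def by (metis UNIV_I imageE)
  show ?thesis
  proof (rule ex1I[of _ w], intro conjI w(1) ballI, clarify)
    fix U \<phi> assume U: "(U, \<phi>) \<in> atlas E" "x \<in> U"
    obtain g where "complex_linear g" "\<And>v. v \<in> fibre E x \<Longrightarrow> \<phi> v = blinfun_apply g (\<psi> v)"
      using transition[OF chart(1) U(1) chart(2) U(2)] by blast
    then show "\<phi> w = c *\<^sub>C \<phi> v" using w v by (simp add: complex_linear_def)
  next
    fix w' assume w': "w' \<in> fibre E x \<and> (\<forall>(U, \<phi>)\<in>atlas E. x \<in> U \<longrightarrow> \<phi> w' = c *\<^sub>C \<phi> v)"
    then have "\<psi> w' = \<psi> w" using chart w(2) by fastforce
    then show "w' = w" using bij w' w(1) by (auto simp: bij_betw_def dest: inj_onD)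
  qed
qed

lemma fibre_scale_properties:
  assumes "x \<in> D" and v: "v \<in> fibre E x"
  shows "fibre_scale E c v \<in> fibre E x"
    and "(U, \<phi>) \<in> atlas E \<Longrightarrow> x \<in> U \<Longrightarrow> \<phi> (fibre_scale E c v) = c *\<^sub>C \<phi> v"
proof -
  have pv: "proj E v = x" using v by (simp add: fibre_def)
  have "fibre_scale E c v \<in> fibre E x \<and>
      (\<forall>(U, \<phi>)\<in>atlas E. x \<in> U \<longrightarrow> \<phi> (fibre_scale E c v) = c *\<^sub>C \<phi> v)"
    unfolding fibre_scale_def pv by (rule theI'[OF fibre_scale_unique[OF assms]])
  then show "fibre_scale E c v \<in> fibre E x"
    and "(U, \<phi>) \<in> atlas E \<Longrightarrow> x \<in> U \<Longrightarrow> \<phi> (fibre_scale E c v) = c *\<^sub>C \<phi> v"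
    by (auto dest!: bspec)
qed

lemma dual_fibre_fibre_scale:
  assumes "x \<in> D" "v \<in> fibre E x" and \<xi>: "\<xi> \<in> dual_fibre E x"
  shows "\<xi> (fibre_scale E c v) = c * \<xi> v"
proof -
  obtain V \<psi> where chart: "(V, \<psi>) \<in> atlas E" "x \<in> V" using chart_at[OF \<open>x \<in> D\<close>] .
  then obtain l :: "'h \<Rightarrow>\<^sub>L complex" where "complex_linear l" "\<And>v. v \<in> fibre E x \<Longrightarrow> \<xi> v = blinfun_apply l (\<psi> v)"
    using \<xi> unfolding dual_fibre_def by blast
  then show ?thesis
    using fibre_scale_properties(1)[OF assms(1,2)] fibre_scale_properties(2)[OF assms(1,2) chart] assms(2)
    by (simp add: complex_linear_def scaleC_complex_def)
qed

lemma len_fibre_scale_finite: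
  assumes "singular_finsler_metric D E h" "x \<in> D" "v \<in> fibre E x" and r: "h v = ennreal r" "r \<ge> 0"
  shows "len h (fibre_scale E c v) = ennreal (cmod c * sqrt r)"
proof -
  have "h (fibre_scale E c v) = ennreal ((cmod c)\<^sup>2 * r)"
    using assms by (simp add: singular_finsler_metric_def ennreal_mult)
  then show ?thesis
    using r by (simp add: len_def enn_powr_def powr_half_sqrt real_sqrt_mult)
qed

text \<open>A vector of length 0 on which \<open>\<xi>\<close> does not vanish would make the dual length infinite.\<close>

lemma ex_unit_vector:
  assumes h: "singular_finsler_metric D E h" and x: "x \<in> D" and \<xi>: "\<xi> \<in> dual_fibre E x"
    and t: "ennreal t < dual_len E h x \<xi>" "t \<ge> 0" and finite: "dual_len E h x \<xi> < top"
  shows "\<exists>a\<in>fibre E x. len h a = 1 \<and> t < cmod (\<xi> a)"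
proof -
  have dl: "dual_len E h x \<xi> = (SUP v\<in>{v \<in> fibre E x. len h v \<le> 1}. ennreal (cmod (\<xi> v)))"
    using t by (auto simp: dual_len_def split: if_splits)
  then obtain v where v: "v \<in> fibre E x" "len h v \<le> 1" "t < cmod (\<xi> v)"
    using t by (auto simp: less_SUP_iff ennreal_less_iff)
  have "h v \<noteq> \<infinity>" using v(2) by (auto simp: len_def enn_powr_def top_unique)
  then obtain r where r: "h v = ennreal r" "r \<ge> 0" by (cases "h v") auto
  have "len h v = ennreal (sqrt r)" using r by (simp add: len_def enn_powr_def powr_half_sqrt)
  then have "sqrt r \<le> 1" using v(2) by (simp add: ennreal_le_1)
  note scaled = fibre_scale_properties(1)[OF x v(1)] len_fibre_scale_finite[OF h x v(1) r]
    dual_fibre_fibre_scale[OF x v(1) \<xi>]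
  show ?thesis
  proof (cases "r = 0")
    case True
    obtain b where b: "dual_len E h x \<xi> = ennreal b" "b \<ge> 0"
      using finite by (cases "dual_len E h x \<xi>") auto
    \<comment> \<open>The multiple still has length 0, while \<open>\<xi>\<close> takes the modulus
      \<open>b + 1\<close> on it, exceeding the dual length \<open>b\<close>.\<close>
    define c where "c = (b + 1) / cmod (\<xi> v)"
    have "cmod (\<xi> v) > 0" using v(3) t(2) by linarith
    then have "c * cmod (\<xi> v) = b + 1" "c \<ge> 0" using b by (simp_all add: c_def)
    then have "ennreal (b + 1) = ennreal (cmod (\<xi> (fibre_scale E (complex_of_real c) v)))"
      by (simp only: scaled(3) norm_mult norm_of_real abs_of_nonneg)
    also have "\<dots> \<le> dual_len E h x \<xi>"
      unfolding dl by (rule SUP_upper) (simp add: scaled True)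
    finally show ?thesis using b by (simp add: ennreal_le_iff)
  next
    case False
    then have "sqrt r > 0" using r by simp
    \<comment> \<open>Normalising a vector of length at most 1 does not decrease the modulus of
      \<open>\<xi>\<close>.\<close>
    define a where "a = fibre_scale E (complex_of_real (1 / sqrt r)) v"
    have "cmod (\<xi> a) = cmod (\<xi> v) / sqrt r"
      using \<open>sqrt r > 0\<close> by (simp add: a_def scaled norm_mult norm_divide)
    moreover have "cmod (\<xi> v) \<le> cmod (\<xi> v) / sqrt r"
      using \<open>sqrt r > 0\<close> \<open>sqrt r \<le> 1\<close> by (simp add: le_divide_eq mult_left_le)
    moreover have "len h a = 1" "a \<in> fibre E x"
      using \<open>sqrt r > 0\<close> by (simp_all add: a_def scaled norm_divide)
    ultimately show ?thesis using v by (intro bexI[of _ a]) auto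
  qed
qed

text \<open>In a chart, \<open>s\<close> is represented by Riesz vectors, so the pairing is the
  evaluation of a holomorphic tensor at \<open>m\<close> copies of such a vector. Differentiability
  is local, hence one chart around each point suffices.\<close>

lemma holomorphic_tensor_section_pairing:
  assumes U: "open U" "U \<subseteq> D" and s: "holomorphic_dual_section E U s"
    and f: "holomorphic_tensor_section E m D f"
  shows "holomorphic_map_on U (\<lambda>x. f x (replicate m (s x)))"
  unfolding holomorphic_map_on_def
proof
  fix x assume "x \<in> U"
  then obtain V \<psi> where chart: "(V, \<psi>) \<in> atlas E" "x \<in> V" using chart_at U by blast
  obtain F where F: "holomorphic_map_on (V \<inter> D) F" "\<And>y. y \<in> V \<inter> D \<Longrightarrow> represents E m y \<psi> (F y) (f y)"
    using f chart(1) unfolding holomorphic_tensor_section_def by blast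
  obtain l :: "complex^'n \<Rightarrow> 'h \<Rightarrow>\<^sub>L complex" where l: "holomorphic_map_on (V \<inter> U) l"
    "\<And>y. y \<in> V \<inter> U \<Longrightarrow> complex_linear (l y)"
    "\<And>y v. y \<in> V \<inter> U \<Longrightarrow> v \<in> fibre E y \<Longrightarrow> s y v = blinfun_apply (l y) (\<psi> v)"
    using s chart(1) unfolding holomorphic_dual_section_def by blast
  have dual: "s y \<in> dual_fibre E y" if "y \<in> U" for y
    using s that by (simp add: holomorphic_dual_section_def)
  have eq: "tensor_apply (F y) (replicate m (riesz_vector (l y))) = f y (replicate m (s y))"
    if y: "y \<in> V \<inter> U" for y
  proof -
    \<comment> \<open>Equality of functions also concerns points outside the fibre, where both sides
      are undefined by extensionality.\<close>
    have "s y = frame_dual E y \<psi> (riesz_vector (l y))"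
    proof
      fix v
      show "s y v = frame_dual E y \<psi> (riesz_vector (l y)) v"
        using dual[of y] y l(2,3)[OF y]
        by (auto simp: frame_dual_def dual_fibre_def extensional_def cinner_riesz_vector_complex_linear)
    qed
    moreover have "f y (map (frame_dual E y \<psi>) ws) = tensor_apply (F y) ws" if "length ws = m" for ws
      using F(2)[of y] y U that unfolding represents_def by blast
    ultimately show ?thesis by (metis length_replicate map_replicate)
  qed
  have "holomorphic_map_on (V \<inter> U) F" using F(1) U unfolding holomorphic_map_on_def by blast
  from holomorphic_map_on_tensor_apply_riesz[OF this l(1), of m]
  obtain L where L1: "((\<lambda>y. tensor_apply (F y) (replicate m (riesz_vector (l y)))) has_derivative L) (at x)"
    and L: "\<And>c v. L (c *s v) = c *\<^sub>C L v"
    using chart(2) \<open>x \<in> U\<close> unfolding holomorphic_map_on_def by blast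
  have "((\<lambda>y. f y (replicate m (s y))) has_derivative L) (at x)"
    by (rule has_derivative_transform_within_open[OF L1, of "V \<inter> U"])
      (use chart \<open>x \<in> U\<close> U open_chart[OF chart(1)] eq in auto)
  then show "\<exists>L. ((\<lambda>y. f y (replicate m (s y))) has_derivative L) (at x) \<and> (\<forall>c v. L (c *s v) = c *\<^sub>C L v)"
    using L by blast
qed

end

section \<open>Truncated quotients, semicontinuity and measurability\<close>

text \<open>Truncating \<open>d\<close> at \<open>\<epsilon>\<close> avoids division by zero. An
  infinite \<open>L\<close> makes the bound trivial, and a finite one never meets the excluded
  product of 0 and infinity.\<close>

lemma powr_quotient_le_enn_powr:
  assumes "0 \<le> y" "0 \<le> d" "0 < \<epsilon>" "0 < p"
    and "\<not> (ennreal d ^ m = 0 \<and> L = \<infinity>) \<Longrightarrow> ennreal y \<le> ennreal d ^ m * L"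
  shows "ennreal ((y / max d \<epsilon> ^ m) powr p) \<le> enn_powr L p"
proof (cases L)
  case (real r)
  then have "ennreal y \<le> ennreal (d ^ m * r)"
    using assms by (simp add: ennreal_mult ennreal_power)
  then have "y \<le> d ^ m * r" using assms real by (simp add: ennreal_le_iff)
  also have "\<dots> \<le> max d \<epsilon> ^ m * r"
    using assms real by (intro mult_right_mono power_mono) auto
  finally have "y / max d \<epsilon> ^ m \<le> r"
    using \<open>0 < \<epsilon>\<close> by (simp add: divide_le_eq less_max_iff_disj mult.commute)
  then show ?thesis
    using assms real by (auto simp: enn_powr_def intro!: ennreal_leI powr_mono2)
qed (simp add: enn_powr_def)

text \<open>The sublevel set at a real \<open>r\<close> is that of \<open>f\<close> at
  \<open>exp (r / 2)\<close>; zeros of \<open>f\<close>, with value \<open>- \<infinity>\<close>,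
  belong to both.\<close>

lemma usc_on_enn_ln_power2:
  fixes f :: "'a::topological_space \<Rightarrow> ennreal"
  assumes "usc_on U f"
  shows "usc_on U (\<lambda>x. enn_ln ((f x)\<^sup>2))"
proof -
  have fin: "\<exists>r\<ge>0. f x = ennreal r" if "x \<in> U" for x
    using assms that by (cases "f x") (auto simp: usc_on_def)
  have real: "{x\<in>U. enn_ln ((f x)\<^sup>2) < ereal r} = {x\<in>U. f x < ennreal (exp (r / 2))}" for r
  proof (rule Collect_cong, rule conj_cong[OF refl])
    fix x assume "x \<in> U"
    then obtain q where q: "q \<ge> 0" "f x = ennreal q" using fin by blast
    have "2 * ln q < r \<longleftrightarrow> q < exp (r / 2)" if "q > 0"
      using that by (metis exp_less_cancel_iff exp_ln less_divide_eq_numeral1(1) mult.commute)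
    then show "enn_ln ((f x)\<^sup>2) < ereal r \<longleftrightarrow> f x < ennreal (exp (r / 2))"
      using q by (auto simp: enn_ln_ennreal_power2 ennreal_less_iff)
  qed
  have lt: "enn_ln ((f x)\<^sup>2) < \<infinity>" if "x \<in> U" for x
    using fin[OF that] by (auto simp: enn_ln_ennreal_power2 split: if_splits)
  then have "{x\<in>U. enn_ln ((f x)\<^sup>2) < \<infinity>} = U" by blast
  with real have "openin (top_of_set U) {x\<in>U. enn_ln ((f x)\<^sup>2) < c}" for c
    using assms by (cases c) (auto simp: usc_on_def)
  then show ?thesis using lt by (simp add: usc_on_def top_ereal_def)
qed

lemma borel_measurable_usc_extension:
  fixes f :: "'a::topological_space \<Rightarrow> real"
  assumes "open U" and usc: "\<And>c. open {x\<in>U. f x < c}"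
  shows "(\<lambda>x. if x \<in> U then f x else 0) \<in> borel_measurable borel"
proof (rule borel_measurableI_less)
  fix c
  have "{x \<in> space borel. (if x \<in> U then f x else 0) < c} = {x\<in>U. f x < c} \<union> (if 0 < c then - U else {})"
    by auto
  then show "{x \<in> space borel. (if x \<in> U then f x else 0) < c} \<in> sets borel"
    using usc[of c] \<open>open U\<close> by auto
qed

section \<open>The mean value inequality for the dual lengths of sections\<close>

theorem theorem1p4:
  fixes D :: "(complex^'n) set"
    and E :: "(complex^'n, 'e, 'h::complex_hilbert) vbundle"
    and h :: "'e \<Rightarrow> ennreal"
    and k :: "nat \<Rightarrow> complex^'n \<Rightarrow> (('e \<Rightarrow> complex) list \<Rightarrow> complex) \<Rightarrow> ennreal"
    and p :: real
  assumes "open D" and "connected D" and "D \<noteq> {}"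
    and "holomorphic_vector_bundle D E"
    and "singular_finsler_metric D E h"
    and "\<And>U s. open U \<Longrightarrow> U \<subseteq> D \<Longrightarrow> holomorphic_dual_section E U s \<Longrightarrow>
           usc_on U (\<lambda>x. dual_len E h x (s x))"
    and "\<And>m. m \<ge> 1 \<Longrightarrow> induced_tensor_metric D E h m (k m)"
    and "p > 0"
    and "multiple_coarse_Lp_extension D E h k p"
  shows "griffiths_semipositive D E h"
proof -
  interpret vector_bundle D E by unfold_locales fact
  obtain C :: "nat \<Rightarrow> real" where C0: "\<forall>m\<ge>1. 0 < C m" and C_lim: "(\<lambda>m. ln (C m) / real m) \<longlonglongrightarrow> 0"
    and ext: "\<forall>z\<in>D. \<forall>a\<in>fibre E z. len h a = 1 \<longrightarrow>
      (\<forall>m\<ge>1. \<exists>f. holomorphic_tensor_section E m D f \<and> f z = tensor_pow E m a \<and>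
        (\<integral>\<^sup>+x\<in>D. enn_powr (len (k m x) (f x)) p \<partial>lebesgue) \<le> ennreal (C m))"
    using assms(9) unfolding multiple_coarse_Lp_extension_def by (elim exE conjE)
  have C_pos: "C m > 0" if "m \<ge> 1" for m using C0 that by simp
  have "plurisubharmonic_on U (\<lambda>x. enn_ln ((dual_len E h x (s x))\<^sup>2))"
    if "open U" "U \<subseteq> D" and s: "holomorphic_dual_section E U s" for U s
    unfolding plurisubharmonic_on_def
  proof (intro conjI allI impI)
    define d where "d x = dual_len E h x (s x)" for x
    have usc: "usc_on U d" unfolding d_def[abs_def] using assms(6) that by blast
    then show "usc_on U (\<lambda>x. enn_ln ((dual_len E h x (s x))\<^sup>2))"
      unfolding d_def[abs_def] by (rule usc_on_enn_ln_power2)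
    have dual: "s x \<in> dual_fibre E x" if "x \<in> U" for x
      using s that by (simp add: holomorphic_dual_section_def)
    \<comment> \<open>The real-valued dual length, extended by 0 to a Borel function on the whole
      space.\<close>
    define \<phi> where "\<phi> x = (if x \<in> U then enn2real (d x) else 0)" for x
    have d_eq: "d x = ennreal (\<phi> x)" if "x \<in> U" for x
      using usc that by (simp add: \<phi>_def usc_on_def)
    have \<phi>_nonneg: "0 \<le> \<phi> x" for x by (simp add: \<phi>_def)
    have \<phi>_open: "open {x\<in>U. \<phi> x < c}" for c
    proof (cases "c > 0")
      case True
      then have "{x\<in>U. \<phi> x < c} = {x\<in>U. d x < ennreal c}"
        using d_eq \<phi>_nonneg by (auto simp: ennreal_less_iff)
      then show ?thesis using usc \<open>open U\<close> by (simp add: usc_on_def openin_open_eq)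
    next
      case False
      then have "{x\<in>U. \<phi> x < c} = {}" using \<phi>_nonneg by (auto simp: not_less intro: order_trans)
      then show ?thesis by (simp only: open_empty)
    qed
    have "(\<lambda>x. if x \<in> U then \<phi> x else 0) = \<phi>" by (auto simp: \<phi>_def)
    then have \<phi>_borel: "\<phi> \<in> borel_measurable borel"
      using borel_measurable_usc_extension[OF \<open>open U\<close> \<phi>_open] by simp
    fix z w assume disc: "\<forall>\<zeta>. cmod \<zeta> \<le> 1 \<longrightarrow> z + \<zeta> *s w \<in> U"
    have "z \<in> U" using disc[rule_format, of 0] by simp
    then have "z \<in> D" using that by blast
    \<comment> \<open>The supremum in the dual length need not be attained, so a unit vector is only
      available for \<open>t\<close> strictly below \<open>\<phi> z\<close>; the limit from the left
      follows at the end.\<close>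
    have key: "ereal (2 * ln t) \<le> circle_mean (\<lambda>\<theta>. enn_ln ((ennreal (\<phi> (z + cis \<theta> *s w)))\<^sup>2))"
      if t: "0 < t" "t < \<phi> z" for t
    proof (rule log_le_circle_mean[OF \<open>open U\<close> _ \<phi>_borel \<phi>_nonneg \<phi>_open \<open>0 < t\<close> \<open>p > 0\<close> C_pos C_lim])
      show "z + \<zeta> *s w \<in> U" if "cmod \<zeta> \<le> 1" for \<zeta> using disc that by blast
      fix m :: nat assume "m \<ge> 1"
      have "ennreal t < dual_len E h z (s z)"
        using d_eq[OF \<open>z \<in> U\<close>] t by (simp add: d_def ennreal_less_iff)
      moreover have "dual_len E h z (s z) < top"
        using usc \<open>z \<in> U\<close> by (simp add: usc_on_def d_def)
      ultimately obtain a where a: "a \<in> fibre E z" "len h a = 1" "t < cmod (s z a)"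
        using ex_unit_vector[OF assms(5) \<open>z \<in> D\<close> dual[OF \<open>z \<in> U\<close>] _ less_imp_le[OF t(1)]] by blast
      obtain f where f: "holomorphic_tensor_section E m D f" "f z = tensor_pow E m a"
        "(\<integral>\<^sup>+x\<in>D. enn_powr (len (k m x) (f x)) p \<partial>lebesgue) \<le> ennreal (C m)"
        using ext[rule_format, OF \<open>z \<in> D\<close> a(1,2) \<open>m \<ge> 1\<close>] by blast
      define G where "G x = f x (replicate m (s x))" for x
      \<comment> \<open>Extension by 0 makes the pairing Borel measurable on the whole
        space.\<close>
      define F where "F x = (if x \<in> U then G x else 0)" for x
      have hol: "holomorphic_map_on U G"
        unfolding G_def[abs_def] by (rule holomorphic_tensor_section_pairing[OF \<open>open U\<close> \<open>U \<subseteq> D\<close> s f(1)])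
      have F_borel: "F \<in> borel_measurable borel"
        unfolding F_def[abs_def] using \<open>open U\<close> holomorphic_map_on_imp_continuous_on[OF hol]
        by (intro borel_measurable_continuous_on_if) auto
      have F_hol: "(\<lambda>\<zeta>. F (z + \<zeta> *s v)) holomorphic_on {\<zeta>. z + \<zeta> *s v \<in> U}" for v
        using holomorphic_map_on_line[OF hol, of z v] by (rule holomorphic_transform) (simp add: F_def)
      have "F z = s z a ^ m"
        using \<open>z \<in> U\<close> a(1) dual[OF \<open>z \<in> U\<close>]
        by (auto simp: F_def G_def f(2) tensor_pow_def dual_lists_def fibre_def prod_list_replicate)
      then have Fz: "t ^ m \<le> cmod (F z)"
        using a(3) t by (simp add: norm_power power_mono)
      have "(\<integral>\<^sup>+x\<in>U. ennreal ((cmod (F x) / max (\<phi> x) \<epsilon> ^ m) powr p) \<partial>lborel) \<le> ennreal (C m)"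
        if "\<epsilon> > 0" for \<epsilon>
      proof -
        have "ennreal ((cmod (F x) / max (\<phi> x) \<epsilon> ^ m) powr p) \<le> enn_powr (len (k m x) (f x)) p"
          if "x \<in> U" for x
        proof (rule powr_quotient_le_enn_powr)
          assume nz: "\<not> (ennreal (\<phi> x) ^ m = 0 \<and> len (k m x) (f x) = \<infinity>)"
          have "x \<in> D" "f x \<in> tensor_fibre E m x"
            using \<open>x \<in> U\<close> \<open>U \<subseteq> D\<close> f(1) by (auto simp: holomorphic_tensor_section_def)
          moreover have "ennreal (\<phi> x) ^ m \<noteq> \<infinity>"
            by (simp add: ennreal_power[OF \<phi>_nonneg])
          ultimately have "ennreal (cmod (G x)) \<le> dual_len E h x (s x) ^ m * len (k m x) (f x)"
            using assms(7)[OF \<open>m \<ge> 1\<close>] dual[OF \<open>x \<in> U\<close>] nz d_eq[OF \<open>x \<in> U\<close>]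
            unfolding induced_tensor_metric_def G_def d_def by metis
          then show "ennreal (cmod (F x)) \<le> ennreal (\<phi> x) ^ m * len (k m x) (f x)"
            using d_eq[OF \<open>x \<in> U\<close>] \<open>x \<in> U\<close> by (simp add: F_def d_def)
        qed (use \<phi>_nonneg \<open>\<epsilon> > 0\<close> \<open>p > 0\<close> in auto)
        then have "(\<integral>\<^sup>+x\<in>U. ennreal ((cmod (F x) / max (\<phi> x) \<epsilon> ^ m) powr p) \<partial>lborel)
            \<le> (\<integral>\<^sup>+x\<in>D. enn_powr (len (k m x) (f x)) p \<partial>lborel)"
          using \<open>U \<subseteq> D\<close> by (intro nn_integral_mono) (auto simp: indicator_def)
        \<comment> \<open>The nonnegative integral is a supremum over simple functions, so
          monotonicity and passage to the completed measure do not depend on measurability of the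
          metric on tensors.\<close>
        then show ?thesis using f(3) by (simp add: nn_integral_completion)
      qed
      then show "\<exists>F\<in>borel_measurable borel.
          (\<forall>v. (\<lambda>\<zeta>. F (z + \<zeta> *s v)) holomorphic_on {\<zeta>. z + \<zeta> *s v \<in> U}) \<and> t ^ m \<le> cmod (F z) \<and>
          (\<forall>\<epsilon>>0. (\<integral>\<^sup>+x\<in>U. ennreal ((cmod (F x) / max (\<phi> x) \<epsilon> ^ m) powr p) \<partial>lborel) \<le> ennreal (C m))"
        using F_borel F_hol Fz by (intro bexI[of _ F]) auto
    qed
    have "d (z + cis \<theta> *s w) = ennreal (\<phi> (z + cis \<theta> *s w))" for \<theta>
      using disc by (intro d_eq) simp
    then have mean: "circle_mean (\<lambda>\<theta>. enn_ln ((dual_len E h (z + cis \<theta> *s w) (s (z + cis \<theta> *s w)))\<^sup>2))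
        = circle_mean (\<lambda>\<theta>. enn_ln ((ennreal (\<phi> (z + cis \<theta> *s w)))\<^sup>2))"
      by (simp add: d_def)
    have "enn_ln ((d z)\<^sup>2) \<le> circle_mean (\<lambda>\<theta>. enn_ln ((ennreal (\<phi> (z + cis \<theta> *s w)))\<^sup>2))" (is "_ \<le> ?m")
    proof (cases "\<phi> z = 0")
      case True
      then show ?thesis using d_eq[OF \<open>z \<in> U\<close>] by (simp add: enn_ln_def)
    next
      case False
      then have "\<phi> z > 0" using \<phi>_nonneg[of z] by simp
      have "ereal (2 * ln (\<phi> z)) \<le> ?m"
      proof (rule tendsto_upperbound[of "\<lambda>t. ereal (2 * ln t)" _ "at_left (\<phi> z)"])
        show "((\<lambda>t. ereal (2 * ln t)) \<longlongrightarrow> ereal (2 * ln (\<phi> z))) (at_left (\<phi> z))"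
          using \<open>\<phi> z > 0\<close> by (intro tendsto_intros) auto
        have "eventually (\<lambda>t. t \<in> {0<..<\<phi> z}) (at_left (\<phi> z))"
          using \<open>\<phi> z > 0\<close> by (rule eventually_at_leftI[of 0, rotated]) auto
        then show "eventually (\<lambda>t. ereal (2 * ln t) \<le> ?m) (at_left (\<phi> z))"
          by eventually_elim (use key in auto)
      qed simp
      then show ?thesis using False \<phi>_nonneg d_eq[OF \<open>z \<in> U\<close>] by (simp add: enn_ln_ennreal_power2)
    qed
    then show "enn_ln ((dual_len E h z (s z))\<^sup>2)
        \<le> circle_mean (\<lambda>\<theta>. enn_ln ((dual_len E h (z + cis \<theta> *s w) (s (z + cis \<theta> *s w)))\<^sup>2))"
      unfolding mean d_def .
  qed
  then show ?thesis by (simp add: griffiths_semipositive_def)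
qed

end
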